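(* Let $k\ge1$, let $\mathbf C_\infty\subset SU_2$ be the infinite cyclic group generated by $g=\mathrm{diag}(\zeta^{-1},\zeta)$, where $\zeta=e^{i\theta}$, $\theta\in\mathbb R$, is not a root of unity, and let $Z_k=Z_k(\mathbf C_\infty)=\mathrm{End}_{\mathbf C_\infty}(V^{\otimes k})$ where $V=\mathbb C^2$. Then: (a) $\mathcal B^k(\mathbf C_\infty)=\{\mathsf E_{\mathsf r,\mathsf s}\mid\mathsf r,\mathsf s\in\{-1,1\}^k,\ |\mathsf r|=|\mathsf s|\}$ is a basis for $Z_k$, where $\mathsf E_{\mathsf r,\mathsf s}v_{\mathsf t}=\delta_{\mathsf s,\mathsf t}v_{\mathsf r}$ and $\mathsf E_{\mathsf r,\mathsf s}\mathsf E_{\mathsf t,\mathsf u}=\delta_{\mathsf s,\mathsf t}\mathsf E_{\mathsf r,\mathsf u}$ for all $\mathsf r,\mathsf s,\mathsf t,\mathsf u\in\{-1,1\}^k$. (b) The irreducible modules for $Z_k$ are labeled by $\Lambda_k(\mathbf C_\infty)=\{k-2a\mid a=0,1,\dots,k\}$. A basis for the irreducible $Z_k$-module $Z_k^{(k-2a)}$ is $\{v_{\mathsf r}\mid\mathsf r\in\{-1,1\}^k,\ |\mathsf r|=a\}$, and $\dim Z_k^{(k-2a)}=\binom ka$. The module $Z_k^{(k-2a)}$ is also a $\mathbf C_\infty$-module, hence a $(\mathbf C_\infty\times Z_k)$-bimodule. (c) $\dim Z_k=\displaystyle\sum_{a=0}^k\binom ka^2=\binom{2k}k$, which is the coefficient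 of $z^k$ in $(1+z)^{2k}$. (d) $Z_k$ is isomorphic to the planar rook algebra $\mathsf{PR}_k$.
   Context: $V=\mathbb C^2$ has basis $v_{-1}=(1,0)^t$, $v_1=(0,1)^t$; $\mathbf C_\infty$ acts by matrices on $V$ and diagonally on $V^{\otimes k}$. For $\mathsf r\in\{-1,1\}^k$: $v_{\mathsf r}=v_{r_1}\otimes\cdots\otimes v_{r_k}$ and $|\mathsf r|$ is the number of $i$ with $r_i=-1$. The label $\ell\in\mathbb Z$ refers to the one-dimensional $\mathbf C_\infty$-module on which $g$ acts by $\zeta^\ell$. The planar rook algebra $\mathsf{PR}_k$ is the complex monoid algebra of the planar rook monoid, i.e. the monoid of order-preserving partial injections of $\{1,\dots,k\}$ to itself; it is known to have a basis of matrix units $\{\mathsf X_{\mathsf R,\mathsf S}\mid\mathsf R,\mathsf S\subseteq\{1,\dots,k\},|\mathsf R|=|\mathsf S|\}$ with $\mathsf X_{\mathsf R,\mathsf S}\mathsf X_{\mathsf T,\mathsf U}=\delta_{\mathsf S,\mathsf T}\mathsf X_{\mathsf R,\mathsf U}$. *)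

theory Defs
  imports
    "HOL-Analysis.Analysis"
    "HOL-Library.Function_Algebras"
    "HOL-Computational_Algebra.Polynomial"
    "HOL-Algebra.Generated_Groups"
    "HOL-Algebra.QuotRing"
    "HOL-Algebra.Module"
begin

section \<open>Modules over complex algebras and representations of groups\<close>

text \<open>
  A complex algebra is given by the HOL-Algebra record type \<open>(complex, 'a) module\<close>, i.e. a
  not necessarily commutative ring with a scalar multiplication. The underlying space of a module
  or representation is a subspace \<open>W\<close> of a complex vector space \<open>'w\<close> with scaling \<open>s\<close>;
  only the values of the action on \<open>W\<close> matter.
\<close>

definition basis_of :: "(complex \<Rightarrow> 'w \<Rightarrow> 'w) \<Rightarrow> 'w::ab_group_add set \<Rightarrow> 'w set \<Rightarrow> bool" where
  "basis_of s B W \<longleftrightarrow> B \<subseteq> W \<and> \<not> module.dependent s B \<and> module.span s B = W"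

locale algebra_module = vector_space s
  for A :: "(complex, 'a) module" (structure)
    and s :: "complex \<Rightarrow> 'w::ab_group_add \<Rightarrow> 'w"
    and W :: "'w set"
    and act :: "'a \<Rightarrow> 'w \<Rightarrow> 'w" +
  assumes subspace_W: "subspace W"
    and act_closed: "\<lbrakk>a \<in> carrier A; w \<in> W\<rbrakk> \<Longrightarrow> act a w \<in> W"
    and act_add_right: "\<lbrakk>a \<in> carrier A; u \<in> W; w \<in> W\<rbrakk> \<Longrightarrow> act a (u + w) = act a u + act a w"
    and act_scale_right: "\<lbrakk>a \<in> carrier A; w \<in> W\<rbrakk> \<Longrightarrow> act a (s c w) = s c (act a w)"
    and act_add_left:
      "\<lbrakk>a \<in> carrier A; b \<in> carrier A; w \<in> W\<rbrakk> \<Longrightarrow> act (a \<oplus> b) w = act a w + act b w"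
    and act_scale_left: "\<lbrakk>a \<in> carrier A; w \<in> W\<rbrakk> \<Longrightarrow> act (c \<odot> a) w = s c (act a w)"
    and act_mult:
      "\<lbrakk>a \<in> carrier A; b \<in> carrier A; w \<in> W\<rbrakk> \<Longrightarrow> act (a \<otimes> b) w = act a (act b w)"
    and act_one: "w \<in> W \<Longrightarrow> act \<one> w = w"

locale irreducible_module = algebra_module +
  assumes nonzero: "W \<noteq> {0}"
    and no_proper_submodule:
      "\<lbrakk>subspace U; U \<subseteq> W; \<And>a u. \<lbrakk>a \<in> carrier A; u \<in> U\<rbrakk> \<Longrightarrow> act a u \<in> U\<rbrakk> \<Longrightarrow> U = {0} \<or> U = W"

definition module_isomorphic ::
  "(complex, 'a) module
    \<Rightarrow> (complex \<Rightarrow> 'w::ab_group_add \<Rightarrow> 'w) \<Rightarrow> 'w set \<Rightarrow> ('a \<Rightarrow> 'w \<Rightarrow> 'w)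
    \<Rightarrow> (complex \<Rightarrow> 'u::ab_group_add \<Rightarrow> 'u) \<Rightarrow> 'u set \<Rightarrow> ('a \<Rightarrow> 'u \<Rightarrow> 'u) \<Rightarrow> bool" where
  "module_isomorphic A s W act s' W' act' \<longleftrightarrow>
    (\<exists>\<phi>. bij_betw \<phi> W W'
      \<and> (\<forall>u\<in>W. \<forall>w\<in>W. \<phi> (u + w) = \<phi> u + \<phi> w)
      \<and> (\<forall>c. \<forall>w\<in>W. \<phi> (s c w) = s' c (\<phi> w))
      \<and> (\<forall>a\<in>carrier A. \<forall>w\<in>W. \<phi> (act a w) = act' a (\<phi> w)))"

locale group_module = vector_space s
  for G :: "('g, 'm) monoid_scheme" (structure)
    and s :: "complex \<Rightarrow> 'w::ab_group_add \<Rightarrow> 'w"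
    and W :: "'w set"
    and gact :: "'g \<Rightarrow> 'w \<Rightarrow> 'w" +
  assumes gsubspace_W: "subspace W"
    and gact_closed: "\<lbrakk>g \<in> carrier G; w \<in> W\<rbrakk> \<Longrightarrow> gact g w \<in> W"
    and gact_add: "\<lbrakk>g \<in> carrier G; u \<in> W; w \<in> W\<rbrakk> \<Longrightarrow> gact g (u + w) = gact g u + gact g w"
    and gact_scale: "\<lbrakk>g \<in> carrier G; w \<in> W\<rbrakk> \<Longrightarrow> gact g (s c w) = s c (gact g w)"
    and gact_mult:
      "\<lbrakk>g \<in> carrier G; h \<in> carrier G; w \<in> W\<rbrakk> \<Longrightarrow> gact (g \<otimes> h) w = gact g (gact h w)"
    and gact_one: "w \<in> W \<Longrightarrow> gact \<one> w = w"

definition group_algebra_bimodule ::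
  "('g, 'm) monoid_scheme \<Rightarrow> (complex, 'a) module \<Rightarrow> (complex \<Rightarrow> 'w::ab_group_add \<Rightarrow> 'w)
    \<Rightarrow> 'w set \<Rightarrow> ('g \<Rightarrow> 'w \<Rightarrow> 'w) \<Rightarrow> ('a \<Rightarrow> 'w \<Rightarrow> 'w) \<Rightarrow> bool" where
  "group_algebra_bimodule G A s W gact act \<longleftrightarrow>
    group_module G s W gact \<and> algebra_module A s W act \<and>
    (\<forall>g\<in>carrier G. \<forall>a\<in>carrier A. \<forall>w\<in>W. gact g (act a w) = act a (gact g w))"

definition algebra_isomorphic :: "(complex, 'a) module \<Rightarrow> (complex, 'b) module \<Rightarrow> bool" where
  "algebra_isomorphic A B \<longleftrightarrow>
    (\<exists>\<phi> \<in> ring_iso A B. \<forall>c. \<forall>a\<in>carrier A. \<phi> (c \<odot>\<^bsub>A\<^esub> a) = c \<odot>\<^bsub>B\<^esub> \<phi> a)"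


section \<open>The group generated by \<open>g\<close>\<close>

definition SU2 :: "(complex^2^2) monoid" where
  "SU2 = \<lparr>carrier = {A. A ** transpose (map_matrix cnj A) = mat 1 \<and> det A = 1},
          monoid.mult = (**), one = mat 1\<rparr>"

definition gen :: "complex \<Rightarrow> complex^2^2" where
  "gen \<zeta> = vector [vector [inverse \<zeta>, 0], vector [0, \<zeta>]]"

definition C_inf :: "complex \<Rightarrow> (complex^2^2) monoid" where
  "C_inf \<zeta> = subgroup_generated SU2 {gen \<zeta>}"


section \<open>Tensor powers of \<open>\<complex>\<^sup>2\<close>\<close>

text \<open>
  A tensor is represented by its coordinates with respect to the basis \<open>v\<^sub>r\<close>: the \<open>k\<close>-th tensor
  power of \<open>complex^2\<close> consists of the functions on \<open>{-1,1}\<^sup>k\<close>, extended by zero to all functions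
  of type \<open>nat \<Rightarrow> int\<close>. Addition is the pointwise addition of \<open>Function_Algebras\<close>.
\<close>

type_synonym tensor = "(nat \<Rightarrow> int) \<Rightarrow> complex"

definition signs :: "nat \<Rightarrow> (nat \<Rightarrow> int) set" where
  "signs k = {1..k} \<rightarrow>\<^sub>E {-1, 1}"

definition neg_count :: "nat \<Rightarrow> (nat \<Rightarrow> int) \<Rightarrow> nat" where
  "neg_count k r = card {i \<in> {1..k}. r i = -1}"

definition tensor_space :: "nat \<Rightarrow> tensor set" where
  "tensor_space k = {x. \<forall>r. r \<notin> signs k \<longrightarrow> x r = 0}"

definition tscale :: "complex \<Rightarrow> tensor \<Rightarrow> tensor" where
  "tscale c x = (\<lambda>r. c * x r)"

definition basis_vec :: "int \<Rightarrow> complex^2" where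
  "basis_vec j = (if j = -1 then vector [1, 0] else vector [0, 1])"

definition coord :: "complex^2 \<Rightarrow> int \<Rightarrow> complex" where
  "coord w j = (if j = -1 then w $ 1 else w $ 2)"

definition simple_tensor :: "nat \<Rightarrow> (nat \<Rightarrow> complex^2) \<Rightarrow> tensor" where
  "simple_tensor k w = (\<lambda>r. if r \<in> signs k then \<Prod>i\<in>{1..k}. coord (w i) (r i) else 0)"

definition basis_tensor :: "nat \<Rightarrow> (nat \<Rightarrow> int) \<Rightarrow> tensor" where
  "basis_tensor k r = simple_tensor k (\<lambda>i. basis_vec (r i))"

text \<open>
  The diagonal action of a matrix, defined on the basis and extended linearly;
  see \<open>diag_act_simple_tensor\<close> below.
\<close>

definition diag_act :: "nat \<Rightarrow> complex^2^2 \<Rightarrow> tensor \<Rightarrow> tensor" where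
  "diag_act k A x = (\<Sum>r\<in>signs k. tscale (x r) (simple_tensor k (\<lambda>i. A *v basis_vec (r i))))"


section \<open>The centralizer algebra\<close>

text \<open>
  Linear endomorphisms of \<open>tensor_space k\<close> are extended by zero to functions on the whole type,
  so that equal endomorphisms are equal as functions and sums, scalar multiples and composites
  are the ordinary ones.
\<close>

definition tensor_End :: "nat \<Rightarrow> (tensor \<Rightarrow> tensor) set" where
  "tensor_End k = {f.
     (\<forall>x\<in>tensor_space k. f x \<in> tensor_space k) \<and>
     (\<forall>x\<in>tensor_space k. \<forall>y\<in>tensor_space k. f (x + y) = f x + f y) \<and>
     (\<forall>c. \<forall>x\<in>tensor_space k. f (tscale c x) = tscale c (f x)) \<and>
     (\<forall>x. x \<notin> tensor_space k \<longrightarrow> f x = 0)}"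

definition escale :: "complex \<Rightarrow> (tensor \<Rightarrow> tensor) \<Rightarrow> tensor \<Rightarrow> tensor" where
  "escale c f = (\<lambda>x. tscale c (f x))"

definition Z_alg :: "nat \<Rightarrow> complex \<Rightarrow> (complex, tensor \<Rightarrow> tensor) module" where
  "Z_alg k \<zeta> =
    \<lparr>carrier = {f \<in> tensor_End k. \<forall>h\<in>carrier (C_inf \<zeta>). \<forall>x\<in>tensor_space k.
                  f (diag_act k h x) = diag_act k h (f x)},
     monoid.mult = (\<circ>),
     one = (\<lambda>x. if x \<in> tensor_space k then x else 0),
     ring.zero = 0,
     add = (+),
     smult = escale\<rparr>"

text \<open>The coefficient of \<open>v\<^sub>s\<close> in \<open>x\<close> is \<open>x s\<close>.\<close>

definition E_unit :: "nat \<Rightarrow> (nat \<Rightarrow> int) \<Rightarrow> (nat \<Rightarrow> int) \<Rightarrow> tensor \<Rightarrow> tensor" where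
  "E_unit k r s = (\<lambda>x. if x \<in> tensor_space k then tscale (x s) (basis_tensor k r) else 0)"

text \<open>
  The module labelled by \<open>l\<close> is the isotypic component of the one-dimensional module on which
  \<open>g\<close> acts by \<open>\<zeta>\<^sup>l\<close>. The algebra \<open>Z_alg k \<zeta>\<close> acts on it by evaluation. The labels are those
  for which this one-dimensional module occurs in the tensor power.
\<close>

definition Z_mod :: "nat \<Rightarrow> complex \<Rightarrow> int \<Rightarrow> tensor set" where
  "Z_mod k \<zeta> l = {x \<in> tensor_space k. diag_act k (gen \<zeta>) x = tscale (\<zeta> powi l) x}"

definition eval_act :: "(tensor \<Rightarrow> tensor) \<Rightarrow> tensor \<Rightarrow> tensor" where
  "eval_act f x = f x"

definition labels :: "nat \<Rightarrow> complex \<Rightarrow> int set" where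
  "labels k \<zeta> = {l. Z_mod k \<zeta> l \<noteq> {0}}"


section \<open>The planar rook algebra\<close>

definition planar_rook_monoid :: "nat \<Rightarrow> (nat \<rightharpoonup> nat) monoid" where
  "planar_rook_monoid k =
    \<lparr>carrier = {f. dom f \<subseteq> {1..k} \<and> ran f \<subseteq> {1..k} \<and> inj_on f (dom f) \<and>
                  (\<forall>i\<in>dom f. \<forall>j\<in>dom f. i \<le> j \<longrightarrow> the (f i) \<le> the (f j))},
     monoid.mult = (\<circ>\<^sub>m),
     one = (\<lambda>i. if i \<in> {1..k} then Some i else None)\<rparr>"

definition monoid_algebra :: "('m, 'x) monoid_scheme \<Rightarrow> (complex, 'm \<Rightarrow> complex) module" where
  "monoid_algebra M =
    \<lparr>carrier = {f. finite {x. f x \<noteq> 0} \<and> {x. f x \<noteq> 0} \<subseteq> carrier M},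
     monoid.mult = (\<lambda>f h x. \<Sum>y\<in>{y. f y \<noteq> 0}. \<Sum>z\<in>{z. h z \<noteq> 0}.
                     if y \<otimes>\<^bsub>M\<^esub> z = x then f y * h z else 0),
     one = (\<lambda>x. if x = \<one>\<^bsub>M\<^esub> then 1 else 0),
     ring.zero = 0,
     add = (+),
     smult = (\<lambda>c f x. c * f x)\<rparr>"

definition planar_rook_algebra :: "nat \<Rightarrow> (complex, (nat \<rightharpoonup> nat) \<Rightarrow> complex) module" where
  "planar_rook_algebra k = monoid_algebra (planar_rook_monoid k)"


section \<open>Basic facts\<close>

lemma vector_space_tscale: "vector_space tscale"
  by unfold_locales (auto simp: tscale_def fun_eq_iff algebra_simps)

lemma vector_space_escale: "vector_space escale"
  by unfold_locales (auto simp: escale_def tscale_def fun_eq_iff algebra_simps)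

lemma group_SU2: "group SU2"
proof (rule groupI)
  let ?H = "\<lambda>A::complex^2^2. transpose (map_matrix cnj A)"
  have H_mult: "?H (A ** B) = ?H B ** ?H A" for A B
    by (simp add: vec_eq_iff transpose_def map_matrix_def matrix_matrix_mult_def mult.commute)
  have H_H: "?H (?H A) = A" for A
    by (simp add: vec_eq_iff transpose_def map_matrix_def)
  have det_H: "det (map_matrix cnj A) = cnj (det A)" for A :: "complex^2^2"
    by (simp add: det_2 map_matrix_def)
  show "x \<otimes>\<^bsub>SU2\<^esub> y \<in> carrier SU2" if "x \<in> carrier SU2" "y \<in> carrier SU2" for x y
  proof -
    have "(x ** y) ** ?H (x ** y) = x ** (y ** ?H y) ** ?H x"
      by (simp add: H_mult matrix_mul_assoc)
    then show ?thesis
      using that by (simp add: SU2_def det_mul)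
  qed
  show "\<one>\<^bsub>SU2\<^esub> \<in> carrier SU2"
    by (simp add: SU2_def vec_eq_iff transpose_def map_matrix_def mat_def matrix_matrix_mult_def
        sum_2 det_2 forall_2)
  show "\<exists>y\<in>carrier SU2. y \<otimes>\<^bsub>SU2\<^esub> x = \<one>\<^bsub>SU2\<^esub>" if "x \<in> carrier SU2" for x
  proof (rule bexI)
    have "x ** ?H x = mat 1" using that by (simp add: SU2_def)
    then have "?H x ** x = mat 1" by (simp add: matrix_left_right_inverse)
    then show "?H x \<otimes>\<^bsub>SU2\<^esub> x = \<one>\<^bsub>SU2\<^esub>" "?H x \<in> carrier SU2"
      using that by (simp_all add: SU2_def H_H det_H det_transpose)
  qed
qed (simp_all add: SU2_def matrix_mul_assoc)

lemma gen_in_SU2: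
  assumes "cmod \<zeta> = 1"
  shows "gen \<zeta> \<in> carrier SU2"
proof -
  have "\<zeta> * cnj \<zeta> = 1"
    using assms by (simp add: complex_norm_square [symmetric])
  moreover from this have "inverse \<zeta> * cnj (inverse \<zeta>) = 1"
    by (metis complex_cnj_inverse inverse_1 inverse_mult_distrib)
  moreover have "\<zeta> \<noteq> 0" using assms by auto
  ultimately show ?thesis
    by (simp add: SU2_def gen_def vec_eq_iff transpose_def map_matrix_def mat_def
        matrix_matrix_mult_def sum_2 det_2 forall_2)
qed

lemma finite_signs: "finite (signs k)"
  unfolding signs_def by (intro finite_PiE) auto

lemma basis_tensor_eq:
  assumes "r \<in> signs k"
  shows "basis_tensor k r = (\<lambda>s. if s = r then 1 else 0)"
proof
  fix s
  show "basis_tensor k r s = (if s = r then 1 else 0)"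
  proof (cases "s \<in> signs k")
    case True
    have c: "coord (basis_vec (r i)) (s i) = (if s i = r i then 1 else 0)" if "i \<in> {1..k}" for i
    proof -
      have "r i \<in> {-1, 1}" "s i \<in> {-1, 1}"
        using assms True that unfolding signs_def by (blast dest: PiE_mem)+
      then show ?thesis by (auto simp: coord_def basis_vec_def)
    qed
    have "basis_tensor k r s = (\<Prod>i\<in>{1..k}. if s i = r i then 1 else 0)"
      unfolding basis_tensor_def simple_tensor_def using True c
      by (simp only: if_True) (rule prod.cong; simp)
    also have "\<dots> = (if \<forall>i\<in>{1..k}. s i = r i then 1 else 0)"
      by (auto intro!: prod.neutral)
    also have "(\<forall>i\<in>{1..k}. s i = r i) \<longleftrightarrow> s = r"
      using assms True unfolding signs_def by (metis PiE_ext)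
    finally show ?thesis by simp
  next
    case False
    then show ?thesis using assms by (auto simp: basis_tensor_def simple_tensor_def)
  qed
qed

lemma diag_act_simple_tensor:
  "diag_act k A (simple_tensor k w) = simple_tensor k (\<lambda>i. A *v w i)"
proof
  fix s
  have sum_fun: "sum f S x = (\<Sum>r\<in>S. f r x)" for f :: "(nat \<Rightarrow> int) \<Rightarrow> tensor" and S x
    by (induction S rule: infinite_finite_induct) auto
  show "diag_act k A (simple_tensor k w) s = simple_tensor k (\<lambda>i. A *v w i) s"
  proof (cases "s \<in> signs k")
    case True
    have "diag_act k A (simple_tensor k w) s =
      (\<Sum>r\<in>signs k. \<Prod>i\<in>{1..k}. coord (w i) (r i) * coord (A *v basis_vec (r i)) (s i))"
      using True
      by (simp add: diag_act_def sum_fun tscale_def simple_tensor_def prod.distrib cong: sum.cong)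
    also have "\<dots> = (\<Prod>i\<in>{1..k}. \<Sum>j\<in>{-1,1}. coord (w i) j * coord (A *v basis_vec j) (s i))"
      unfolding signs_def by (rule prod_sum_PiE [symmetric]) auto
    also have "\<dots> = (\<Prod>i\<in>{1..k}. coord (A *v w i) (s i))"
      by (intro prod.cong refl)
        (simp add: coord_def basis_vec_def matrix_vector_mult_def sum_2 algebra_simps)
    finally show ?thesis using True by (simp add: simple_tensor_def)
  next
    case False
    then show ?thesis
      by (simp add: diag_act_def sum_fun tscale_def simple_tensor_def)
  qed
qed

end

theory Submission
  imports Defs
begin

text \<open>
  The generator \<open>g\<close> acts diagonally on the basis of the tensors \<open>v\<^sub>r\<close>, with the eigenvalue
  \<open>\<zeta>\<^sup>k\<^sup>-\<^sup>2\<^sup>a\<close> for \<open>a = neg_count k r\<close> (\<open>diag_act_gen\<close>). As \<open>\<zeta>\<close> is not a root of unity, different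
  \<open>a\<close> give different eigenvalues. Hence the tensor power is the direct sum of the eigenspaces
  \<open>weight_space k a\<close>, and an endomorphism commutes with \<open>g\<close> if and only if its matrix is block
  diagonal for this decomposition (\<open>carrier_Z_alg\<close>). So the centralizer algebra is a product of full
  matrix algebras, one for each \<open>a \<le> k\<close>, of size \<open>k choose a\<close>. The matrix units within the blocks are
  its basis, and its dimension is a sum of squares, which Vandermonde's identity evaluates.

  The module theory comes from the rank one operators \<open>rank_one k s x\<close>, which send \<open>y\<close> to
  \<open>y s\<close> times \<open>x\<close>. A nonzero vector of a weight space has a nonzero coordinate \<open>s\<close>, so these operators
  move it to every other vector of the weight space, which is therefore irreducible. In an arbitrary
  irreducible module \<open>W\<close>, the identity is the sum of the diagonal units, so some \<open>E_unit k r r\<close> is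
  nonzero on some \<open>w\<close>; then sending \<open>x\<close> to \<open>rank_one k r x\<close> applied to \<open>w\<close> identifies the weight
  space containing \<open>v\<^sub>r\<close> with \<open>W\<close> (\<open>irreducible_module_is_weight_space\<close>).

  For the planar rook algebra, a sign sequence is regarded as the set of its positions with sign
  \<open>-1\<close>. A planar rook \<open>f\<close> acts by sending \<open>v\<^sub>s\<close> to \<open>v\<^sub>r\<close>, where the set of \<open>r\<close> is the image under \<open>f\<close>
  of the set of \<open>s\<close>, and by sending \<open>v\<^sub>s\<close> to \<open>0\<close> if \<open>f\<close> is not defined on that whole set. This is a
  representation \<open>rook_rep\<close> of the monoid algebra, and \<open>f\<close> is the sum of the matrix unit given by
  its full domain and range and of matrix units for smaller subsets. Since a planar rook is determined
  by its domain and range, and every two subsets of equal size occur as such (\<open>planar_rook_unique\<close>,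
  \<open>planar_rook_exists\<close>), the change from planar rooks to matrix units is unitriangular. So
  \<open>rook_rep\<close> is injective (\<open>rook_coefficients_zero\<close>) and hits all matrix units of the centralizer
  algebra (\<open>E_unit_in_image_rook_rep\<close>).
\<close>


section \<open>Bases from dual families of functionals\<close>

text \<open>
  The functionals \<open>p i\<close> read off coefficients. So a vanishing combination has vanishing
  coefficients, and \<open>w\<close> minus the combination with coefficients \<open>p i w\<close> is killed by all of them.
\<close>

lemma basis_of_dual_family:
  fixes s :: "complex \<Rightarrow> 'w::ab_group_add \<Rightarrow> 'w" and e :: "'i \<Rightarrow> 'w"
  assumes vs: "vector_space s" and I: "finite I"
    and W: "module.subspace s W" and e: "\<And>i. i \<in> I \<Longrightarrow> e i \<in> W"
    and p_add: "\<And>i x y. p i (x + y) = p i x + (p i y :: complex)"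
    and p_scale: "\<And>i c x. p i (s c x) = c * p i x"
    and dual: "\<And>i j. i \<in> I \<Longrightarrow> j \<in> I \<Longrightarrow> p i (e j) = (if i = j then 1 else 0)"
    and separating: "\<And>w. w \<in> W \<Longrightarrow> (\<And>i. i \<in> I \<Longrightarrow> p i w = 0) \<Longrightarrow> w = 0"
  shows "basis_of s (e ` I) W" and "vector_space.dim s W = card I"
proof -
  interpret vector_space s by (rule vs)
  have p_0: "p i 0 = 0" for i using p_add[of i 0 0] by simp
  have p_sum: "p i (\<Sum>j\<in>J. s (c j) (e j)) = (\<Sum>j\<in>J. c j * p i (e j))" for i c J
    by (induction J rule: infinite_finite_induct) (simp_all add: p_0 p_add p_scale)
  have inj: "inj_on e I"
    by (rule inj_onI) (metis dual zero_neq_one)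
  have coordinate: "p i (\<Sum>j\<in>I. s (c j) (e j)) = c i" if "i \<in> I" for i c
  proof -
    have "p i (\<Sum>j\<in>I. s (c j) (e j)) = (\<Sum>j\<in>I. if i = j then c j else 0)"
      unfolding p_sum using that by (intro sum.cong) (auto simp: dual)
    then show ?thesis using I that by simp
  qed
  have indep: "independent (e ` I)"
  proof (rule independent_if_scalars_zero)
    show "finite (e ` I)" using I by simp
    fix c x assume 0: "(\<Sum>x\<in>e ` I. s (c x) x) = 0" and "x \<in> e ` I"
    then obtain i where i: "i \<in> I" "x = e i" by auto
    have "(\<Sum>j\<in>I. s (c (e j)) (e j)) = 0"
      using 0 by (simp add: sum.reindex[OF inj])
    then show "c x = 0" using coordinate[OF i(1), of "\<lambda>j. c (e j)"] by (simp add: p_0 i)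
  qed
  have "W \<subseteq> span (e ` I)"
  proof
    fix w assume w: "w \<in> W"
    let ?v = "\<Sum>j\<in>I. s (p j w) (e j)"
    have "?v \<in> W" by (intro subspace_sum[OF W] subspace_scale[OF W] e)
    moreover have "p i (w - ?v) = 0" if "i \<in> I" for i
      using coordinate[OF that, of "\<lambda>j. p j w"] p_add[of i "w - ?v" ?v] by simp
    ultimately have "w - ?v = 0" by (intro separating subspace_diff[OF W] w)
    moreover have "?v \<in> span (e ` I)"
      by (intro span_sum span_scale span_base imageI)
    ultimately show "w \<in> span (e ` I)" by simp
  qed
  moreover have "span (e ` I) \<subseteq> W" using e W by (intro span_minimal) auto
  ultimately have span: "span (e ` I) = W" by auto
  show "basis_of s (e ` I) W" using e indep span by (auto simp: basis_of_def)
  have "dim W = card (e ` I)" using span span_span indep by (intro dim_eq_card) metis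
  then show "dim W = card I" by (simp add: card_image[OF inj])
qed


section \<open>Sign sequences\<close>

definition neg_set :: "nat \<Rightarrow> (nat \<Rightarrow> int) \<Rightarrow> nat set" where
  "neg_set k r = {i \<in> {1..k}. r i = -1}"

lemma neg_count_eq_card: "neg_count k r = card (neg_set k r)"
  by (simp add: neg_count_def neg_set_def)

lemma finite_neg_set: "finite (neg_set k r)"
  by (simp add: neg_set_def)

lemma neg_count_le: "neg_count k r \<le> k"
proof -
  have "card (neg_set k r) \<le> card {1..k}"
    by (rule card_mono) (auto simp: neg_set_def)
  then show ?thesis by (simp add: neg_count_eq_card)
qed

lemma bij_betw_neg_set: "bij_betw (neg_set k) (signs k) (Pow {1..k})"
proof (rule bij_betw_byWitness[where f' = "\<lambda>S. \<lambda>i\<in>{1..k}. if i \<in> S then -1 else 1"])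
  show "\<forall>r\<in>signs k. (\<lambda>i\<in>{1..k}. if i \<in> neg_set k r then -1 else 1) = r"
  proof
    fix r assume r: "r \<in> signs k"
    then have "r i \<in> {-1, 1}" if "i \<in> {1..k}" for i
      using that unfolding signs_def by (blast dest: PiE_mem)
    moreover have "r i = undefined" if "i \<notin> {1..k}" for i
      using r that unfolding signs_def by (rule PiE_arb)
    ultimately show "(\<lambda>i\<in>{1..k}. if i \<in> neg_set k r then -1 else 1) = r"
      by (auto simp: fun_eq_iff restrict_def neg_set_def)
  qed
qed (auto simp: neg_set_def signs_def)

lemma neg_set_inject:
  "r \<in> signs k \<Longrightarrow> s \<in> signs k \<Longrightarrow> neg_set k r = neg_set k s \<longleftrightarrow> r = s"
  using bij_betw_neg_set by (auto simp: bij_betw_def inj_on_def)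

lemma neg_set_surj:
  assumes "S \<subseteq> {1..k}" obtains r where "r \<in> signs k" "neg_set k r = S"
  using bij_betw_imp_surj_on[OF bij_betw_neg_set[of k]] assms by (auto simp: image_iff set_eq_iff) metis

text \<open>
  Sign sequences correspond to their sets of negative positions, so this counts the subsets of size
  \<open>a\<close>.
\<close>

lemma card_signs_neg_count: "card {r \<in> signs k. neg_count k r = a} = k choose a"
proof -
  have "bij_betw (neg_set k) {r \<in> signs k. neg_count k r = a} {S \<in> Pow {1..k}. card S = a}"
    using bij_betw_neg_set by (rule bij_betw_Collect) (simp add: neg_count_eq_card)
  from bij_betw_same_card[OF this] show ?thesis
    using n_subsets[of "{1..k}" a] by simp
qed

lemma card_pairs_equal_neg_count:
  "card {(r, s). r \<in> signs k \<and> s \<in> signs k \<and> neg_count k r = neg_count k s}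
    = (\<Sum>a=0..k. (k choose a)\<^sup>2)"
proof -
  let ?L = "\<lambda>a. {r \<in> signs k. neg_count k r = a}"
  have "{(r, s). r \<in> signs k \<and> s \<in> signs k \<and> neg_count k r = neg_count k s}
      = (\<Union>a\<in>{0..k}. ?L a \<times> ?L a)"
    using neg_count_le by auto
  also have "card \<dots> = (\<Sum>a=0..k. card (?L a \<times> ?L a))"
    using finite_signs by (intro card_UN_disjoint) auto
  finally show ?thesis
    by (simp only: card_cartesian_product card_signs_neg_count power2_eq_square)
qed


section \<open>Tensors and endomorphisms in coordinates\<close>

interpretation tensor: vector_space tscale
  by (rule vector_space_tscale)

interpretation endo: vector_space escale
  by (rule vector_space_escale)

lemma sum_apply: "sum f S x = (\<Sum>i\<in>S. f i x)"
  for f :: "'i \<Rightarrow> 'a \<Rightarrow> 'b::comm_monoid_add"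
  by (induction S rule: infinite_finite_induct) auto

lemma subspace_tensor_space: "tensor.subspace (tensor_space k)"
  by (auto simp: tensor.subspace_def tensor_space_def tscale_def)

lemma basis_tensor_in_tensor_space: "basis_tensor k r \<in> tensor_space k"
  by (auto simp: basis_tensor_def tensor_space_def simple_tensor_def)

lemma basis_tensor_apply: "r \<in> signs k \<Longrightarrow> basis_tensor k r s = (if s = r then 1 else 0)"
  by (simp add: basis_tensor_eq)

lemma tensor_expansion:
  assumes "x \<in> tensor_space k"
  shows "x = (\<Sum>s\<in>signs k. tscale (x s) (basis_tensor k s))"
proof
  fix r
  have "(\<Sum>s\<in>signs k. tscale (x s) (basis_tensor k s)) r
      = (\<Sum>s\<in>signs k. if r = s then x s else 0)"
    unfolding sum_apply by (intro sum.cong) (auto simp: tscale_def basis_tensor_apply)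
  also have "\<dots> = x r"
    using assms by (simp add: finite_signs tensor_space_def)
  finally show "x r = (\<Sum>s\<in>signs k. tscale (x s) (basis_tensor k s)) r" ..
qed

text \<open>
  The coefficient of \<open>v\<^sub>r\<close> in the image of \<open>v\<^sub>s\<close>: row index first, as in \<open>E_unit k r s\<close>.
\<close>

definition entry :: "nat \<Rightarrow> (tensor \<Rightarrow> tensor) \<Rightarrow> (nat \<Rightarrow> int) \<Rightarrow> (nat \<Rightarrow> int) \<Rightarrow> complex" where
  "entry k f r s = f (basis_tensor k s) r"

lemma entry_add: "entry k (f + g) r s = entry k f r s + entry k g r s"
  by (simp add: entry_def)

lemma entry_escale: "entry k (escale c f) r s = c * entry k f r s"
  by (simp add: entry_def escale_def tscale_def)

lemma tensor_End_closed: "f \<in> tensor_End k \<Longrightarrow> x \<in> tensor_space k \<Longrightarrow> f x \<in> tensor_space k"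
  and tensor_End_add: "f \<in> tensor_End k \<Longrightarrow> x \<in> tensor_space k \<Longrightarrow> y \<in> tensor_space k
        \<Longrightarrow> f (x + y) = f x + f y"
  and tensor_End_scale: "f \<in> tensor_End k \<Longrightarrow> x \<in> tensor_space k \<Longrightarrow> f (tscale c x) = tscale c (f x)"
  and tensor_End_outside: "f \<in> tensor_End k \<Longrightarrow> x \<notin> tensor_space k \<Longrightarrow> f x = 0"
  by (simp_all add: tensor_End_def)

lemma tensor_End_zero: "f \<in> tensor_End k \<Longrightarrow> f 0 = 0"
  using tensor_End_scale[of f k 0 0] tensor.subspace_0[OF subspace_tensor_space, of k]
  by (simp only: tensor.scale_zero_left)

lemma tensor_End_apply:
  assumes f: "f \<in> tensor_End k" and x: "x \<in> tensor_space k"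
  shows "f x r = (\<Sum>s\<in>signs k. entry k f r s * x s)"
proof -
  note T = subspace_tensor_space[of k] and b = basis_tensor_in_tensor_space[of k]
  have "f (\<Sum>s\<in>S. tscale (x s) (basis_tensor k s))
      = (\<Sum>s\<in>S. tscale (x s) (f (basis_tensor k s)))" if "finite S" for S
    using that
  proof induction
    case empty
    then show ?case by (simp only: sum.empty tensor_End_zero[OF f])
  next
    case (insert s S)
    have "(\<Sum>s\<in>S. tscale (x s) (basis_tensor k s)) \<in> tensor_space k"
      by (intro tensor.subspace_sum[OF T] tensor.subspace_scale[OF T] b)
    with insert show ?case
      by (simp only: sum.insert tensor_End_add[OF f] tensor_End_scale[OF f] b
          tensor.subspace_scale[OF T] simp_thms)
  qed
  from this[OF finite_signs[of k]] have "f x = (\<Sum>s\<in>signs k. tscale (x s) (f (basis_tensor k s)))"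
    by (simp flip: tensor_expansion[OF x])
  then show ?thesis by (simp add: sum_apply tscale_def entry_def mult.commute)
qed

text \<open>
  The extension by zero outside the tensor power makes equality of functions the same as equality of
  matrices.
\<close>

lemma tensor_End_eqI:
  assumes f: "f \<in> tensor_End k" and g: "g \<in> tensor_End k"
    and eq: "\<And>r s. r \<in> signs k \<Longrightarrow> s \<in> signs k \<Longrightarrow> entry k f r s = entry k g r s"
  shows "f = g"
proof (intro ext)
  fix x r
  consider "x \<notin> tensor_space k" | "x \<in> tensor_space k" "r \<notin> signs k"
    | "x \<in> tensor_space k" "r \<in> signs k" by blast
  then show "f x r = g x r"
  proof cases
    case 1
    then show ?thesis using tensor_End_outside[OF f] tensor_End_outside[OF g] by simp
  next
    case 2
    then show ?thesis
      using tensor_End_closed[OF f 2(1)] tensor_End_closed[OF g 2(1)] by (simp add: tensor_space_def)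
  next
    case 3
    then show ?thesis using tensor_End_apply[OF f] tensor_End_apply[OF g] eq by simp
  qed
qed

lemma subspace_tensor_End: "endo.subspace (tensor_End k)"
  using subspace_tensor_space[of k]
  unfolding endo.subspace_def tensor.subspace_def tensor_End_def escale_def
  by (auto simp: algebra_simps tensor.scale_right_distrib)

lemma tensor_End_comp: "f \<in> tensor_End k \<Longrightarrow> g \<in> tensor_End k \<Longrightarrow> f \<circ> g \<in> tensor_End k"
  using tensor_End_zero[of f k] by (auto simp: tensor_End_def zero_fun_def)

lemma tensor_End_one: "(\<lambda>x. if x \<in> tensor_space k then x else 0) \<in> tensor_End k"
  using subspace_tensor_space[of k] by (auto simp: tensor_End_def tensor.subspace_def)

lemma entry_comp:
  assumes "f \<in> tensor_End k" "g \<in> tensor_End k"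
  shows "entry k (f \<circ> g) r s = (\<Sum>t\<in>signs k. entry k f r t * entry k g t s)"
  using tensor_End_apply[OF assms(1) tensor_End_closed[OF assms(2) basis_tensor_in_tensor_space]]
  by (simp add: entry_def)

text \<open>
  The tensor \<open>x\<close> times the \<open>s\<close>-th coordinate functional. For a sign sequence \<open>s\<close>, taking \<open>x\<close> to this
  operator embeds the tensor power into its endomorphisms as a left module (\<open>comp_rank_one\<close>), which is how vectors of a weight
  space are made to act on other modules.
\<close>

definition rank_one :: "nat \<Rightarrow> (nat \<Rightarrow> int) \<Rightarrow> tensor \<Rightarrow> tensor \<Rightarrow> tensor" where
  "rank_one k s x = (\<lambda>y. if y \<in> tensor_space k then tscale (y s) x else 0)"

lemma E_unit_eq_rank_one: "E_unit k r s = rank_one k s (basis_tensor k r)"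
  by (simp add: E_unit_def rank_one_def)

lemma rank_one_in_tensor_End: "x \<in> tensor_space k \<Longrightarrow> rank_one k s x \<in> tensor_End k"
  using subspace_tensor_space[of k]
  by (auto simp: tensor_End_def rank_one_def tensor.subspace_def)
     (auto simp: tscale_def fun_eq_iff algebra_simps)

lemma rank_one_add: "rank_one k s (x + y) = rank_one k s x + rank_one k s y"
  by (auto simp: rank_one_def tscale_def fun_eq_iff algebra_simps)

lemma rank_one_scale: "rank_one k s (tscale c x) = escale c (rank_one k s x)"
  by (auto simp: rank_one_def tscale_def escale_def fun_eq_iff)

lemma comp_rank_one:
  "f \<in> tensor_End k \<Longrightarrow> x \<in> tensor_space k \<Longrightarrow> f \<circ> rank_one k s x = rank_one k s (f x)"
  by (auto simp: rank_one_def tensor_End_scale tensor_End_zero fun_eq_iff)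

lemma E_unit_in_tensor_End: "E_unit k r s \<in> tensor_End k"
  by (simp add: E_unit_eq_rank_one rank_one_in_tensor_End basis_tensor_in_tensor_space)

lemma entry_E_unit:
  assumes "r \<in> signs k" "u \<in> signs k"
  shows "entry k (E_unit k r s) t u = (if t = r \<and> u = s then 1 else 0)"
proof -
  have "entry k (E_unit k r s) t u = basis_tensor k u s * basis_tensor k r t"
    by (simp add: entry_def E_unit_def basis_tensor_in_tensor_space tscale_def)
  then show ?thesis using assms by (auto simp: basis_tensor_apply)
qed

lemma E_unit_basis_tensor:
  "t \<in> signs k \<Longrightarrow> E_unit k r s (basis_tensor k t) = (if s = t then basis_tensor k r else 0)"
  by (auto simp: E_unit_def basis_tensor_in_tensor_space)
     (auto simp: basis_tensor_apply[of t] tscale_def)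

lemma E_unit_comp:
  assumes "t \<in> signs k"
  shows "E_unit k r s \<circ> E_unit k t u = (if s = t then E_unit k r u else 0)"
  unfolding E_unit_eq_rank_one[of k t u]
    comp_rank_one[OF E_unit_in_tensor_End basis_tensor_in_tensor_space] E_unit_basis_tensor[OF assms]
  by (auto simp: E_unit_eq_rank_one rank_one_def tscale_def fun_eq_iff)


section \<open>The action of the cyclic group\<close>

text \<open>
  The matrices \<open>gen c\<close> for nonzero \<open>c\<close> form a torus, and it is easier to compute with all of them than
  with the powers of \<open>gen \<zeta>\<close> only.
\<close>

lemma gen_mult: "gen c ** gen d = gen (c * d)"
  by (simp add: gen_def vec_eq_iff matrix_matrix_mult_def sum_2 forall_2)

lemma gen_1: "gen 1 = mat 1"
  by (simp add: gen_def vec_eq_iff mat_def forall_2)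

lemma C_inf_elements:
  assumes "cmod \<zeta> = 1" "h \<in> carrier (C_inf \<zeta>)"
  obtains n where "h = gen (\<zeta> powi n)"
proof -
  interpret SU2: group SU2 by (rule group_SU2)
  have z: "\<zeta> \<noteq> 0" using assms by auto
  have "h \<in> generate SU2 {gen \<zeta>}"
    using assms gen_in_SU2 by (simp add: C_inf_def carrier_subgroup_generated)
  then have "\<exists>n. h = gen (\<zeta> powi n)"
  proof induction
    case one
    show ?case by (rule exI[of _ 0]) (simp add: SU2_def gen_1)
  next
    case (incl h)
    then show ?case by (intro exI[of _ 1]) simp
  next
    case (inv h)
    have "gen (\<zeta> powi (-1)) = inv\<^bsub>SU2\<^esub> gen \<zeta>"
      using assms z gen_in_SU2[of \<zeta>] gen_in_SU2[of "inverse \<zeta>"]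
      by (intro SU2.inv_equality[symmetric])
         (simp_all add: SU2_def gen_mult gen_1 norm_inverse power_int_minus)
    with inv show ?case by (intro exI[of _ "-1"]) simp
  next
    case (eng h1 h2)
    then obtain m n where "h1 = gen (\<zeta> powi m)" "h2 = gen (\<zeta> powi n)" by auto
    then show ?case
      using z by (intro exI[of _ "m + n"]) (simp add: SU2_def gen_mult power_int_add)
  qed
  then show thesis using that by auto
qed

lemma gen_act_basis_vec: "gen c *v basis_vec j = (if j = -1 then inverse c else c) *s basis_vec j"
  by (simp add: gen_def basis_vec_def vec_eq_iff matrix_vector_mult_def sum_2 forall_2)

text \<open>
  Each of the \<open>a\<close> negative signs contributes a factor \<open>c\<^sup>-\<^sup>1\<close> and each of the \<open>k - a\<close> positive ones a
  factor \<open>c\<close>.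
\<close>

lemma simple_tensor_gen_basis_vec:
  assumes c: "c \<noteq> 0"
  shows "simple_tensor k (\<lambda>i. gen c *v basis_vec (r i))
    = tscale (c powi (int k - 2 * int (neg_count k r))) (basis_tensor k r)"
proof -
  have "simple_tensor k (\<lambda>i. gen c *v basis_vec (r i))
      = tscale (\<Prod>i\<in>{1..k}. if r i = -1 then inverse c else c) (basis_tensor k r)"
    by (auto simp: simple_tensor_def gen_act_basis_vec coord_def tscale_def basis_tensor_def
        fun_eq_iff simp flip: prod.distrib intro!: prod.cong)
  also have "(\<Prod>i\<in>{1..k}. if r i = -1 then inverse c else c)
      = inverse c ^ neg_count k r * c ^ card ({1..k} - neg_set k r)"
  proof -
    have "{1..k} \<inter> {i. r i = -1} = neg_set k r"
      and "{1..k} \<inter> - {i. r i = -1} = {1..k} - neg_set k r"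
      by (auto simp: neg_set_def)
    then show ?thesis
      by (subst prod.If_cases) (simp_all only: prod_constant neg_count_eq_card finite_atLeastAtMost)
  qed
  also have "card ({1..k} - neg_set k r) = k - neg_count k r"
    unfolding neg_count_eq_card by (subst card_Diff_subset) (auto simp: neg_set_def)
  also have "inverse c ^ neg_count k r * c ^ (k - neg_count k r)
      = c powi (int k - 2 * int (neg_count k r))"
  proof -
    have "int k - 2 * int (neg_count k r) = - int (neg_count k r) + int (k - neg_count k r)"
      using neg_count_le[of k r] by simp
    then have "c powi (int k - 2 * int (neg_count k r))
        = c powi (- int (neg_count k r)) * c powi int (k - neg_count k r)"
      using c by (simp only: power_int_add simp_thms)
    then show ?thesis by (simp add: power_int_minus power_inverse)
  qed
  finally show ?thesis .
qed

lemma diag_act_gen: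
  assumes "c \<noteq> 0" "x \<in> tensor_space k"
  shows "diag_act k (gen c) x = (\<lambda>r. c powi (int k - 2 * int (neg_count k r)) * x r)" (is "_ = ?y")
proof -
  have "?y \<in> tensor_space k" using assms by (simp add: tensor_space_def)
  then show ?thesis
    by (subst tensor_expansion[of ?y k])
       (simp_all add: diag_act_def simple_tensor_gen_basis_vec[OF assms(1)] mult.commute)
qed

lemma diag_act_in_tensor_space: "diag_act k h x \<in> tensor_space k"
  unfolding diag_act_def using subspace_tensor_space
  by (intro tensor.subspace_sum tensor.subspace_scale)
     (auto simp: tensor_space_def simple_tensor_def)

lemma powi_inject_if_not_root_of_unity:
  assumes z: "cmod \<zeta> = 1" and nr: "\<forall>n::nat. n > 0 \<longrightarrow> \<zeta> ^ n \<noteq> 1"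
  shows "\<zeta> powi m = \<zeta> powi n \<longleftrightarrow> m = n"
proof -
  have z0: "\<zeta> \<noteq> 0" using z by auto
  have *: "\<zeta> powi m \<noteq> \<zeta> powi n" if "m < n" for m n
  proof
    assume "\<zeta> powi m = \<zeta> powi n"
    then have "\<zeta> powi (n - m) = 1" using z0 by (simp add: power_int_diff)
    then have "\<zeta> ^ nat (n - m) = 1" using that by (simp add: power_int_def)
    then show False using nr that by simp
  qed
  show ?thesis using *[of m n] *[of n m] by (metis linorder_neqE)
qed

section \<open>Weight spaces and block diagonal endomorphisms\<close>

text \<open>
  The span of the tensors \<open>v\<^sub>r\<close> with \<open>a\<close> negative signs, and below it the block diagonal endomorphisms.
  Both are free of \<open>\<zeta>\<close>; they turn out to be \<open>Z_mod k \<zeta> (k - 2 a)\<close> and the carrier of \<open>Z_alg k \<zeta>\<close>.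
\<close>

definition weight_space :: "nat \<Rightarrow> nat \<Rightarrow> tensor set" where
  "weight_space k a = {x \<in> tensor_space k. \<forall>r\<in>signs k. neg_count k r \<noteq> a \<longrightarrow> x r = 0}"

definition weight_End :: "nat \<Rightarrow> (tensor \<Rightarrow> tensor) set" where
  "weight_End k = {f \<in> tensor_End k.
     \<forall>r\<in>signs k. \<forall>s\<in>signs k. neg_count k r \<noteq> neg_count k s \<longrightarrow> entry k f r s = 0}"

text \<open>
  Commuting with \<open>gen \<zeta>\<close> multiplies the entry at \<open>r\<close>, \<open>s\<close> by the eigenvalue at \<open>r\<close> on one side
  and by the eigenvalue at \<open>s\<close> on the other. So it must vanish where these differ, that is, where the
  numbers of negative signs differ. Conversely, every element of the group is a scalar on each block.
\<close>

lemma carrier_Z_alg: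
  assumes z: "cmod \<zeta> = 1" and nr: "\<forall>n::nat. n > 0 \<longrightarrow> \<zeta> ^ n \<noteq> 1"
  shows "carrier (Z_alg k \<zeta>) = weight_End k"
proof -
  have z0: "\<zeta> \<noteq> 0" using z by auto
  interpret SU2: group SU2 by (rule group_SU2)
  have "entry k f r s = 0"
    if f: "f \<in> carrier (Z_alg k \<zeta>)" and rs: "r \<in> signs k" "s \<in> signs k"
      and ne: "neg_count k r \<noteq> neg_count k s" for f r s
  proof -
    have fE: "f \<in> tensor_End k" using f by (simp add: Z_alg_def)
    note b = basis_tensor_in_tensor_space[of k s]
    have "gen \<zeta> \<in> carrier (C_inf \<zeta>)"
      using SU2.subgroup_generated_subset_carrier_subset[of "{gen \<zeta>}"] gen_in_SU2[OF z]
      by (auto simp: C_inf_def)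
    with f b have "f (diag_act k (gen \<zeta>) (basis_tensor k s))
        = diag_act k (gen \<zeta>) (f (basis_tensor k s))"
      by (simp add: Z_alg_def)
    moreover have "diag_act k (gen \<zeta>) (basis_tensor k s)
        = tscale (\<zeta> powi (int k - 2 * int (neg_count k s))) (basis_tensor k s)"
      unfolding diag_act_gen[OF z0 b] tscale_def
      by (rule ext) (simp add: basis_tensor_apply[OF rs(2)])
    ultimately have "tscale (\<zeta> powi (int k - 2 * int (neg_count k s))) (f (basis_tensor k s))
        = diag_act k (gen \<zeta>) (f (basis_tensor k s))"
      by (simp add: tensor_End_scale[OF fE b])
    then have "\<zeta> powi (int k - 2 * int (neg_count k s)) * entry k f r s
        = \<zeta> powi (int k - 2 * int (neg_count k r)) * entry k f r s"
      by (simp add: diag_act_gen[OF z0 tensor_End_closed[OF fE b]] tscale_def entry_def fun_eq_iff)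
    then show ?thesis using ne by (simp add: powi_inject_if_not_root_of_unity[OF z nr])
  qed
  moreover have "f (diag_act k h x) = diag_act k h (f x)"
    if f: "f \<in> weight_End k" and h: "h \<in> carrier (C_inf \<zeta>)" and x: "x \<in> tensor_space k" for f h x
  proof
    fix r
    have fE: "f \<in> tensor_End k" using f by (simp add: weight_End_def)
    obtain n where n: "h = gen (\<zeta> powi n)" using C_inf_elements[OF z h] .
    define c where "c = \<zeta> powi n"
    have c: "c \<noteq> 0" using z0 by (simp add: c_def)
    show "f (diag_act k h x) r = diag_act k h (f x) r"
    proof (cases "r \<in> signs k")
      case True
      have "f (diag_act k h x) r = (\<Sum>s\<in>signs k. entry k f r s * diag_act k h x s)"
        by (rule tensor_End_apply[OF fE diag_act_in_tensor_space])
      also have "\<dots> = (\<Sum>s\<in>signs k.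
          c powi (int k - 2 * int (neg_count k r)) * (entry k f r s * x s))"
      proof (rule sum.cong)
        fix s assume "s \<in> signs k"
        with True f have "neg_count k s = neg_count k r" if "entry k f r s \<noteq> 0"
          using that by (force simp: weight_End_def)
        then show "entry k f r s * diag_act k h x s
            = c powi (int k - 2 * int (neg_count k r)) * (entry k f r s * x s)"
          unfolding n c_def[symmetric] diag_act_gen[OF c x] by auto
      qed simp
      also have "\<dots> = diag_act k h (f x) r"
        unfolding n c_def[symmetric] diag_act_gen[OF c tensor_End_closed[OF fE x]]
        by (simp add: tensor_End_apply[OF fE x] sum_distrib_left)
      finally show ?thesis .
    next
      case False
      then show ?thesis
        using tensor_End_closed[OF fE diag_act_in_tensor_space, of h x]
          diag_act_in_tensor_space[of k h "f x"] by (simp add: tensor_space_def)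
    qed
  qed
  ultimately show ?thesis unfolding weight_End_def Z_alg_def by auto
qed

lemma Z_mod_eq_weight_space:
  assumes z: "cmod \<zeta> = 1" and nr: "\<forall>n::nat. n > 0 \<longrightarrow> \<zeta> ^ n \<noteq> 1"
  shows "Z_mod k \<zeta> l
    = {x \<in> tensor_space k. \<forall>r\<in>signs k. int k - 2 * int (neg_count k r) \<noteq> l \<longrightarrow> x r = 0}"
proof -
  have z0: "\<zeta> \<noteq> 0" using z by auto
  have "diag_act k (gen \<zeta>) x = tscale (\<zeta> powi l) x
    \<longleftrightarrow> (\<forall>r\<in>signs k. int k - 2 * int (neg_count k r) \<noteq> l \<longrightarrow> x r = 0)"
    if x: "x \<in> tensor_space k" for x
    using x powi_inject_if_not_root_of_unity[OF z nr]
    by (auto simp: diag_act_gen[OF z0 x] tscale_def fun_eq_iff tensor_space_def)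
  then show ?thesis by (auto simp: Z_mod_def)
qed

lemma weight_End_subset: "f \<in> weight_End k \<Longrightarrow> f \<in> tensor_End k"
  and weight_space_subset: "x \<in> weight_space k a \<Longrightarrow> x \<in> tensor_space k"
  by (simp_all add: weight_End_def weight_space_def)

lemma weight_End_entry:
  "f \<in> weight_End k \<Longrightarrow> r \<in> signs k \<Longrightarrow> s \<in> signs k \<Longrightarrow> neg_count k r \<noteq> neg_count k s
    \<Longrightarrow> entry k f r s = 0"
  by (simp add: weight_End_def)

lemma subspace_weight_space: "tensor.subspace (weight_space k a)"
  using subspace_tensor_space[of k] unfolding tensor.subspace_def weight_space_def
  by (auto simp: tscale_def)

lemma subspace_weight_End: "endo.subspace (weight_End k)"
  using subspace_tensor_End[of k] unfolding endo.subspace_def weight_End_def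
  by (auto simp: entry_add entry_escale) (simp add: entry_def)

lemma weight_End_apply:
  assumes f: "f \<in> weight_End k" and x: "x \<in> weight_space k a"
  shows "f x \<in> weight_space k a"
proof -
  note fE = weight_End_subset[OF f] and xT = weight_space_subset[OF x]
  have "f x r = 0" if "r \<in> signs k" "neg_count k r \<noteq> a" for r
    unfolding tensor_End_apply[OF fE xT]
    using f x that by (intro sum.neutral) (force simp: weight_End_def weight_space_def)
  then show ?thesis using tensor_End_closed[OF fE xT] by (simp add: weight_space_def)
qed

lemma weight_End_one: "(\<lambda>x. if x \<in> tensor_space k then x else 0) \<in> weight_End k"
  using tensor_End_one[of k]
  by (auto simp: weight_End_def entry_def basis_tensor_in_tensor_space basis_tensor_apply)

lemma basis_tensor_in_weight_space:
  "r \<in> signs k \<Longrightarrow> neg_count k r = a \<Longrightarrow> basis_tensor k r \<in> weight_space k a"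
  using basis_tensor_in_tensor_space[of k r] by (auto simp: weight_space_def basis_tensor_apply)

lemma rank_one_in_weight_End:
  assumes "x \<in> weight_space k (neg_count k s)" and s: "s \<in> signs k"
  shows "rank_one k s x \<in> weight_End k"
proof -
  have "entry k (rank_one k s x) t u = 0"
    if "t \<in> signs k" "u \<in> signs k" "neg_count k t \<noteq> neg_count k u" for t u
    using assms that basis_tensor_apply[OF that(2)]
    by (auto simp: entry_def rank_one_def tscale_def weight_space_def)
  then show ?thesis
    using rank_one_in_tensor_End[OF weight_space_subset[OF assms(1)]] by (simp add: weight_End_def)
qed

lemma E_unit_in_weight_End:
  "r \<in> signs k \<Longrightarrow> s \<in> signs k \<Longrightarrow> neg_count k r = neg_count k s \<Longrightarrow> E_unit k r s \<in> weight_End k"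
  by (simp add: E_unit_eq_rank_one rank_one_in_weight_End basis_tensor_in_weight_space)

lemma basis_of_weight_space:
  shows "basis_of tscale {basis_tensor k r | r. r \<in> signs k \<and> neg_count k r = a} (weight_space k a)"
    and "vector_space.dim tscale (weight_space k a) = k choose a"
proof -
  let ?I = "{r \<in> signs k. neg_count k r = a}"
  have fin: "finite ?I" using finite_signs by simp
  have sep: "x = 0"
    if x: "x \<in> weight_space k a" and 0: "\<And>r. r \<in> ?I \<Longrightarrow> x r = 0" for x
  proof
    fix r show "x r = 0 r"
      using x 0[of r] by (cases "r \<in> signs k") (auto simp: weight_space_def tensor_space_def)
  qed
  have im: "{basis_tensor k r | r. r \<in> signs k \<and> neg_count k r = a} = basis_tensor k ` ?I"
    by auto
  note dual = basis_of_dual_family[where p = "\<lambda>r x. x r" and e = "basis_tensor k",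
      OF vector_space_tscale fin subspace_weight_space _ _ _ _ sep]
  show "basis_of tscale {basis_tensor k r | r. r \<in> signs k \<and> neg_count k r = a} (weight_space k a)"
    unfolding im
    by (rule dual) (auto simp: basis_tensor_in_weight_space tscale_def basis_tensor_apply)
  have "vector_space.dim tscale (weight_space k a) = card ?I"
    by (rule dual) (auto simp: basis_tensor_in_weight_space tscale_def basis_tensor_apply)
  then show "vector_space.dim tscale (weight_space k a) = k choose a"
    by (simp add: card_signs_neg_count)
qed

lemma basis_of_weight_End:
  shows "basis_of escale
      {E_unit k r s | r s. r \<in> signs k \<and> s \<in> signs k \<and> neg_count k r = neg_count k s} (weight_End k)"
    and "vector_space.dim escale (weight_End k) = (\<Sum>a=0..k. (k choose a)\<^sup>2)"
proof -
  let ?I = "{(r, s). r \<in> signs k \<and> s \<in> signs k \<and> neg_count k r = neg_count k s}"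
  have fin: "finite ?I"
    by (rule finite_subset[of _ "signs k \<times> signs k"]) (auto simp: finite_signs)
  have sep: "f = 0"
    if f: "f \<in> weight_End k" and 0: "\<And>p. p \<in> ?I \<Longrightarrow> entry k f (fst p) (snd p) = 0" for f
  proof (rule tensor_End_eqI)
    fix r s assume "r \<in> signs k" "s \<in> signs k"
    then show "entry k f r s = entry k 0 r s"
      using weight_End_entry[OF f, of r s] 0[of "(r, s)"] by (auto simp: entry_def)
  qed (use weight_End_subset[OF f] endo.subspace_0[OF subspace_tensor_End] in auto)
  have im: "{E_unit k r s | r s. r \<in> signs k \<and> s \<in> signs k \<and> neg_count k r = neg_count k s}
      = (\<lambda>p. E_unit k (fst p) (snd p)) ` ?I"
    by force
  note dual = basis_of_dual_family[where p = "\<lambda>p f. entry k f (fst p) (snd p)"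
      and e = "\<lambda>p. E_unit k (fst p) (snd p)",
      OF vector_space_escale fin subspace_weight_End _ _ _ _ sep]
  show "basis_of escale
      {E_unit k r s | r s. r \<in> signs k \<and> s \<in> signs k \<and> neg_count k r = neg_count k s} (weight_End k)"
    unfolding im
    by (rule dual) (auto simp: E_unit_in_weight_End entry_add entry_escale entry_E_unit split: if_splits)
  have "vector_space.dim escale (weight_End k) = card ?I"
    by (rule dual) (auto simp: E_unit_in_weight_End entry_add entry_escale entry_E_unit split: if_splits)
  then show "vector_space.dim escale (weight_End k) = (\<Sum>a=0..k. (k choose a)\<^sup>2)"
    by (simp add: card_pairs_equal_neg_count)
qed


section \<open>Irreducible modules\<close>

text \<open>
  It is more convenient to give maps out of the concrete module \<open>W'\<close> than out of an abstract \<open>W\<close>, so an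
  isomorphism is specified here by its inverse.
\<close>

lemma module_isomorphicI_inverse:
  assumes bij: "bij_betw \<psi> W' W"
    and add: "\<And>x y. x \<in> W' \<Longrightarrow> y \<in> W' \<Longrightarrow> x + y \<in> W' \<and> \<psi> (x + y) = \<psi> x + \<psi> y"
    and scale: "\<And>c x. x \<in> W' \<Longrightarrow> s' c x \<in> W' \<and> \<psi> (s' c x) = s c (\<psi> x)"
    and act: "\<And>a x. a \<in> carrier A \<Longrightarrow> x \<in> W' \<Longrightarrow> act' a x \<in> W' \<and> \<psi> (act' a x) = act a (\<psi> x)"
  shows "module_isomorphic A s W act s' W' act'"
proof -
  let ?\<phi> = "inv_into W' \<psi>"
  have \<phi>: "?\<phi> w \<in> W'" "\<psi> (?\<phi> w) = w" if "w \<in> W" for w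
    using bij that by (auto simp: bij_betw_def inv_into_into f_inv_into_f)
  have \<phi>_eq: "?\<phi> w = x" if "x \<in> W'" "\<psi> x = w" for w x
    using bij that by (auto simp: bij_betw_def)
  show ?thesis
    unfolding module_isomorphic_def
  proof (intro exI[of _ ?\<phi>] conjI ballI allI)
    show "bij_betw ?\<phi> W W'" by (rule bij_betw_inv_into[OF bij])
  qed (use add scale act \<phi> in \<open>auto intro!: \<phi>_eq\<close>)
qed

context
  fixes \<zeta> :: complex and k :: nat
  assumes z: "cmod \<zeta> = 1" and nr: "\<forall>n::nat. n > 0 \<longrightarrow> \<zeta> ^ n \<noteq> 1"
begin

lemma Z_alg_simps:
  "carrier (Z_alg k \<zeta>) = weight_End k"
  "f \<otimes>\<^bsub>Z_alg k \<zeta>\<^esub> g = f \<circ> g"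
  "\<one>\<^bsub>Z_alg k \<zeta>\<^esub> = (\<lambda>x. if x \<in> tensor_space k then x else 0)"
  "f \<oplus>\<^bsub>Z_alg k \<zeta>\<^esub> g = f + g"
  "c \<odot>\<^bsub>Z_alg k \<zeta>\<^esub> f = escale c f"
  using carrier_Z_alg[OF z nr] by (simp_all add: Z_alg_def)

lemma Z_mod_weight_space: "Z_mod k \<zeta> (int k - 2 * int a) = weight_space k a"
  by (auto simp: Z_mod_eq_weight_space[OF z nr] weight_space_def)

lemma labels_eq: "labels k \<zeta> = {int k - 2 * int a | a. a \<in> {0..k}}"
proof (intro equalityI subsetI)
  fix l assume "l \<in> labels k \<zeta>"
  moreover have "0 \<in> Z_mod k \<zeta> l"
    by (simp add: Z_mod_eq_weight_space[OF z nr] tensor_space_def)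
  ultimately obtain x where x: "x \<in> Z_mod k \<zeta> l" "x \<noteq> 0" by (auto simp: labels_def)
  then obtain r where "x r \<noteq> 0" by (auto simp: fun_eq_iff)
  with x have "l = int k - 2 * int (neg_count k r)"
    by (auto simp: Z_mod_eq_weight_space[OF z nr] tensor_space_def)
  then show "l \<in> {int k - 2 * int a | a. a \<in> {0..k}}" using neg_count_le by auto
next
  fix l assume "l \<in> {int k - 2 * int a | a. a \<in> {0..k}}"
  then obtain a where a: "l = int k - 2 * int a" "a \<le> k" by auto
  obtain r where r: "r \<in> signs k" "neg_set k r = {1..a}"
    using neg_set_surj[of "{1..a}" k] a by auto
  then have "basis_tensor k r \<in> weight_space k a" "basis_tensor k r r = 1"
    by (auto simp: basis_tensor_in_weight_space neg_count_eq_card basis_tensor_apply)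
  then show "l \<in> labels k \<zeta>"
    using Z_mod_weight_space[of a] a by (auto simp: labels_def)
qed

lemma algebra_module_weight_space: "algebra_module (Z_alg k \<zeta>) tscale (weight_space k a) eval_act"
proof
  show "tensor.subspace (weight_space k a)" by (rule subspace_weight_space)
qed (auto simp: Z_alg_simps eval_act_def weight_End_apply escale_def
    tensor_End_add[OF weight_End_subset weight_space_subset weight_space_subset]
    tensor_End_scale[OF weight_End_subset weight_space_subset] weight_space_subset)

text \<open>
  If \<open>u s\<close> is not \<open>0\<close>, then \<open>rank_one k s x\<close> takes \<open>u\<close> to a nonzero multiple of \<open>x\<close>.
\<close>

lemma irreducible_weight_space:
  assumes "a \<le> k"
  shows "irreducible_module (Z_alg k \<zeta>) tscale (weight_space k a) eval_act"
proof -
  interpret algebra_module "Z_alg k \<zeta>" tscale "weight_space k a" eval_act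
    by (rule algebra_module_weight_space)
  show ?thesis
  proof
    show "weight_space k a \<noteq> {0}"
      using labels_eq Z_mod_weight_space[of a] assms by (auto simp: labels_def)
    fix U
    assume U: "tensor.subspace U" "U \<subseteq> weight_space k a"
      and inv: "\<And>f u. f \<in> carrier (Z_alg k \<zeta>) \<Longrightarrow> u \<in> U \<Longrightarrow> eval_act f u \<in> U"
    show "U = {0} \<or> U = weight_space k a"
    proof (rule disjCI)
      assume "U \<noteq> weight_space k a"
      show "U = {0}"
      proof (rule ccontr)
        assume "U \<noteq> {0}"
        then obtain u where u: "u \<in> U" "u \<noteq> 0"
          using tensor.subspace_0[OF U(1)] by auto
        then obtain s where s: "u s \<noteq> 0" by (auto simp: fun_eq_iff)
        have uW: "u \<in> weight_space k a" using u U by auto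
        then have sk: "s \<in> signs k" "neg_count k s = a"
          using s by (auto simp: weight_space_def tensor_space_def)
        have "weight_space k a \<subseteq> U"
        proof
          fix x assume x: "x \<in> weight_space k a"
          then have "rank_one k s x u \<in> U"
            using inv[of "rank_one k s x" u] u sk
            by (simp add: Z_alg_simps rank_one_in_weight_End eval_act_def)
          then have "tscale (u s) x \<in> U" using weight_space_subset[OF uW] by (simp add: rank_one_def)
          then have "tscale (inverse (u s)) (tscale (u s) x) \<in> U"
            by (rule tensor.subspace_scale[OF U(1)])
          then show "x \<in> U" using s by simp
        qed
        with U \<open>U \<noteq> weight_space k a\<close> show False by auto
      qed
    qed
  qed
qed

text \<open>
  The idempotent \<open>E_unit k r r\<close> is nonzero on the weight space containing \<open>v\<^sub>r\<close> and zero on all the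
  others.
\<close>

lemma weight_spaces_not_isomorphic:
  assumes "a \<le> k"
    and "module_isomorphic (Z_alg k \<zeta>) tscale (weight_space k a) eval_act tscale (weight_space k b) eval_act"
  shows "a = b"
proof (rule ccontr)
  assume "a \<noteq> b"
  obtain \<phi> where bij: "bij_betw \<phi> (weight_space k a) (weight_space k b)"
    and \<phi>_scale: "\<And>c w. w \<in> weight_space k a \<Longrightarrow> \<phi> (tscale c w) = tscale c (\<phi> w)"
    and \<phi>_act: "\<And>f w. f \<in> weight_End k \<Longrightarrow> w \<in> weight_space k a \<Longrightarrow> \<phi> (f w) = f (\<phi> w)"
    using assms(2) by (auto simp: module_isomorphic_def Z_alg_simps eval_act_def)
  obtain r where r: "r \<in> signs k" "neg_set k r = {1..a}"
    using neg_set_surj[of "{1..a}" k] assms by auto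
  then have ra: "neg_count k r = a" by (simp add: neg_count_eq_card)
  let ?b = "basis_tensor k r"
  have b: "?b \<in> weight_space k a" using r ra by (simp add: basis_tensor_in_weight_space)
  have \<phi>b: "\<phi> ?b \<in> weight_space k b" using bij b by (auto simp: bij_betw_def)
  have "\<phi> ?b = \<phi> (E_unit k r r ?b)" using r by (simp add: E_unit_basis_tensor)
  also have "\<dots> = E_unit k r r (\<phi> ?b)" using r b by (intro \<phi>_act E_unit_in_weight_End) auto
  also have "\<dots> = tscale (\<phi> ?b r) ?b"
    using weight_space_subset[OF \<phi>b] by (simp add: E_unit_def)
  also have "\<phi> ?b r = 0" using \<phi>b r ra \<open>a \<noteq> b\<close> by (auto simp: weight_space_def)
  also have "tscale 0 ?b = tscale 0 (\<phi> ?b)" by simp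
  also have "\<dots> = \<phi> (tscale 0 ?b)" by (simp only: \<phi>_scale[OF b])
  finally have "?b = tscale 0 ?b"
    by (rule inj_onD[OF bij_betw_imp_inj_on[OF bij] _ b
          tensor.subspace_scale[OF subspace_weight_space b]])
  then have "?b r = 0" by (metis tscale_def mult_zero_left)
  then show False using r by (simp add: basis_tensor_apply)
qed

text \<open>
  The isomorphism is \<open>\<psi>\<close> below. It is a homomorphism because \<open>f \<circ> rank_one k r x = rank_one k r (f x)\<close>.
  It is injective because \<open>E_unit k r s\<close> takes \<open>\<psi> x\<close> to \<open>x s\<close> times the nonzero vector \<open>\<psi> v\<^sub>r\<close>, and
  surjective because its image is a nonzero submodule of \<open>W\<close>.
\<close>

lemma irreducible_module_is_weight_space:
  fixes sc :: "complex \<Rightarrow> 'w::ab_group_add \<Rightarrow> 'w"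
  assumes "irreducible_module (Z_alg k \<zeta>) sc W act"
  obtains a where "a \<le> k"
    "module_isomorphic (Z_alg k \<zeta>) sc W act tscale (weight_space k a) eval_act"
proof -
  interpret irreducible_module "Z_alg k \<zeta>" sc W act by (rule assms)
  note act_rules = act_closed act_add_right act_scale_right act_add_left act_scale_left act_mult
    act_one
  note act = act_rules[unfolded Z_alg_simps]
  obtain w where w: "w \<in> W" "w \<noteq> 0" using nonzero subspace_0[OF subspace_W] by auto
  \<comment> \<open>Otherwise the identity, which is the sum of all the \<open>E_unit k r r\<close>, would kill \<open>w\<close>.\<close>
  have "\<exists>r\<in>signs k. act (E_unit k r r) w \<noteq> 0"
  proof (rule ccontr)
    assume "\<not> ?thesis"
    then have 0: "act (E_unit k r r) w = 0" if "r \<in> signs k" for r using that by auto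
    have "(\<Sum>r\<in>J. E_unit k r r) \<in> weight_End k \<and> act (\<Sum>r\<in>J. E_unit k r r) w = 0"
      if "finite J" "J \<subseteq> signs k" for J
      using that
    proof induction
      case empty
      then show ?case
        using act(5)[OF weight_End_one w(1), of 0] endo.subspace_0[OF subspace_weight_End]
        by (simp only: sum.empty endo.scale_zero_left scale_zero_left simp_thms)
    next
      case (insert r J)
      then have r: "r \<in> signs k" "E_unit k r r \<in> weight_End k"
        and IH: "(\<Sum>r\<in>J. E_unit k r r) \<in> weight_End k" "act (\<Sum>r\<in>J. E_unit k r r) w = 0"
        by (simp_all add: E_unit_in_weight_End)
      show ?case
        unfolding sum.insert[OF insert(1,2)] act(4)[OF r(2) IH(1) w(1)] IH(2) 0[OF r(1)]
        using endo.subspace_add[OF subspace_weight_End r(2) IH(1)]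
        by (simp only: add_0_right simp_thms)
    qed
    note sum = this[OF finite_signs order_refl]
    have "(\<Sum>r\<in>signs k. E_unit k r r) = (\<lambda>x. if x \<in> tensor_space k then x else 0)"
    proof
      fix x
      show "(\<Sum>r\<in>signs k. E_unit k r r) x = (if x \<in> tensor_space k then x else 0)"
        using tensor_expansion[of x k] by (simp add: sum_apply[of _ _ x] E_unit_def)
    qed
    with sum act(7)[OF w(1)] w show False by simp
  qed
  then obtain r where r: "r \<in> signs k" and ne: "act (E_unit k r r) w \<noteq> 0" by auto
  define X where "X = weight_space k (neg_count k r)"
  define \<psi> where "\<psi> x = act (rank_one k r x) w" for x
  have XT: "x \<in> tensor_space k" if "x \<in> X" for x using that weight_space_subset by (simp add: X_def)
  have R: "rank_one k r x \<in> weight_End k" if "x \<in> X" for x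
    using that r by (simp add: X_def rank_one_in_weight_End)
  have \<psi>W: "\<psi> x \<in> W" if "x \<in> X" for x
    using that w by (simp add: \<psi>_def act R)
  have X: "tensor.subspace X" by (simp add: X_def subspace_weight_space)
  have \<psi>_add: "x + y \<in> X \<and> \<psi> (x + y) = \<psi> x + \<psi> y" if "x \<in> X" "y \<in> X" for x y
    using that w tensor.subspace_add[OF X] by (simp add: \<psi>_def rank_one_add act R)
  have \<psi>_scale: "tscale c x \<in> X \<and> \<psi> (tscale c x) = sc c (\<psi> x)" if "x \<in> X" for c x
    using that w tensor.subspace_scale[OF X] by (simp add: \<psi>_def rank_one_scale act R)
  have \<psi>_act: "f x \<in> X \<and> \<psi> (f x) = act f (\<psi> x)" if f: "f \<in> weight_End k" and x: "x \<in> X" for f x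
  proof
    show "f x \<in> X" using weight_End_apply[OF f] x by (simp add: X_def)
    show "\<psi> (f x) = act f (\<psi> x)"
      using act(6)[OF f R[OF x] w(1)]
      by (simp add: \<psi>_def comp_rank_one[OF weight_End_subset[OF f] XT[OF x]])
  qed
  have br: "basis_tensor k r \<in> X" using r by (simp add: X_def basis_tensor_in_weight_space)
  have \<psi>_basis: "\<psi> (basis_tensor k r) \<noteq> 0"
    using ne by (simp add: \<psi>_def E_unit_eq_rank_one)
  have kernel: "x = 0" if x: "x \<in> X" and 0: "\<psi> x = 0" for x
  proof
    fix s show "x s = 0 s"
    proof (cases "s \<in> signs k \<and> neg_count k s = neg_count k r")
      case True
      then have E: "E_unit k r s \<in> weight_End k" using r by (simp add: E_unit_in_weight_End)
      have "sc (x s) (\<psi> (basis_tensor k r)) = \<psi> (E_unit k r s x)"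
        using \<psi>_scale[OF br] XT[OF x] by (simp add: E_unit_def)
      also have "\<dots> = act (E_unit k r s) (sc 0 w)" using \<psi>_act[OF E x] 0 by simp
      also have "\<dots> = 0" unfolding act(3)[OF E w(1)] by simp
      finally show ?thesis using \<psi>_basis by simp
    next
      case False
      then show ?thesis using x by (auto simp: X_def weight_space_def tensor_space_def)
    qed
  qed
  have "inj_on \<psi> X"
  proof (rule inj_onI)
    fix x y assume xy: "x \<in> X" "y \<in> X" "\<psi> x = \<psi> y"
    then have "\<psi> (x - y) + \<psi> y = \<psi> y"
      using \<psi>_add[of "x - y" y] tensor.subspace_diff[OF X] by simp
    then have "x - y = 0" using kernel[of "x - y"] xy tensor.subspace_diff[OF X] by simp
    then show "x = y" by simp
  qed
  moreover have "\<psi> ` X = {0} \<or> \<psi> ` X = W"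
  proof (rule no_proper_submodule)
    show "subspace (\<psi> ` X)"
    proof (rule subspaceI)
      have "\<psi> (tscale 0 (basis_tensor k r)) = 0" using \<psi>_scale[OF br, of 0] by simp
      then show "0 \<in> \<psi> ` X" using \<psi>_scale[OF br, of 0] by (metis imageI)
    next
      fix u v assume "u \<in> \<psi> ` X" "v \<in> \<psi> ` X"
      then show "u + v \<in> \<psi> ` X" using \<psi>_add by (metis (no_types, lifting) image_iff)
    next
      fix c u assume "u \<in> \<psi> ` X"
      then show "sc c u \<in> \<psi> ` X" using \<psi>_scale by (metis (no_types, lifting) image_iff)
    qed
    show "\<psi> ` X \<subseteq> W" using \<psi>W by auto
    fix f u assume "f \<in> carrier (Z_alg k \<zeta>)" "u \<in> \<psi> ` X"
    then show "act f u \<in> \<psi> ` X"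
      using \<psi>_act by (metis (no_types, lifting) Z_alg_simps(1) image_iff)
  qed
  ultimately have bij: "bij_betw \<psi> X W" using \<psi>_basis br by (auto simp: bij_betw_def)
  have "module_isomorphic (Z_alg k \<zeta>) sc W act tscale X eval_act"
    using bij \<psi>_add \<psi>_scale \<psi>_act
    by (intro module_isomorphicI_inverse) (auto simp: Z_alg_simps eval_act_def)
  then show thesis using that[OF neg_count_le] by (simp add: X_def)
qed

lemma bimodule_weight_space:
  "group_algebra_bimodule (C_inf \<zeta>) (Z_alg k \<zeta>) tscale (weight_space k a) (diag_act k) eval_act"
proof -
  have z0: "\<zeta> \<noteq> 0" using z by auto
  note subT = weight_space_subset
  have "group_module (C_inf \<zeta>) tscale (weight_space k a) (diag_act k)"
  proof
    show "tensor.subspace (weight_space k a)" by (rule subspace_weight_space)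
  next
    fix h x assume h: "h \<in> carrier (C_inf \<zeta>)" and x: "x \<in> weight_space k a"
    obtain c where c: "c \<noteq> 0" "h = gen c"
      using C_inf_elements[OF z h] z0 by (metis power_int_eq_0_iff)
    have act: "diag_act k h y = (\<lambda>r. c powi (int k - 2 * int (neg_count k r)) * y r)"
      if "y \<in> weight_space k a" for y
      using that c by (simp add: diag_act_gen weight_space_subset)
    show "diag_act k h x \<in> weight_space k a"
      unfolding act[OF x] using x by (simp add: weight_space_def tensor_space_def)
    show "diag_act k h (tscale b x) = tscale b (diag_act k h x)" for b
      unfolding act[OF x] act[OF tensor.subspace_scale[OF subspace_weight_space x]]
      by (simp add: tscale_def mult.left_commute)
    show "diag_act k h (x + y) = diag_act k h x + diag_act k h y" if y: "y \<in> weight_space k a" for y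
      unfolding act[OF x] act[OF y] act[OF tensor.subspace_add[OF subspace_weight_space x y]]
      by (rule ext) (simp add: distrib_left)
    fix g assume g: "g \<in> carrier (C_inf \<zeta>)"
    obtain d where d: "d \<noteq> 0" "g = gen d"
      using C_inf_elements[OF z g] z0 by (metis power_int_eq_0_iff)
    have "g \<otimes>\<^bsub>C_inf \<zeta>\<^esub> h = gen (d * c)"
      by (simp add: C_inf_def SU2_def subgroup_generated_def c d gen_mult)
    moreover have "diag_act k (gen (d * c)) x
        = (\<lambda>r. (d * c) powi (int k - 2 * int (neg_count k r)) * x r)"
      using c d x by (intro diag_act_gen) (auto intro: weight_space_subset)
    moreover have "diag_act k g (diag_act k h x)
        = (\<lambda>r. d powi (int k - 2 * int (neg_count k r)) * diag_act k h x r)"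
      unfolding d(2) by (rule diag_act_gen[OF d(1) diag_act_in_tensor_space])
    ultimately show "diag_act k (g \<otimes>\<^bsub>C_inf \<zeta>\<^esub> h) x = diag_act k g (diag_act k h x)"
      by (simp only: act[OF x] power_int_mult_distrib mult.assoc)
  next
    fix x assume "x \<in> weight_space k a"
    then show "diag_act k \<one>\<^bsub>C_inf \<zeta>\<^esub> x = x"
      using diag_act_gen[of 1 x k] by (simp add: C_inf_def SU2_def gen_1 subT)
  qed
  moreover have "diag_act k h (f x) = f (diag_act k h x)"
    if "h \<in> carrier (C_inf \<zeta>)" "f \<in> carrier (Z_alg k \<zeta>)" "x \<in> weight_space k a" for h f x
    using that subT by (simp add: Z_alg_def)
  ultimately show ?thesis
    using algebra_module_weight_space by (simp add: group_algebra_bimodule_def eval_act_def)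
qed

end

section \<open>The planar rook algebra\<close>

abbreviation planar_rooks :: "nat \<Rightarrow> (nat \<rightharpoonup> nat) set" where
  "planar_rooks k \<equiv> carrier (planar_rook_monoid k)"

lemma planar_rooks_iff:
  "f \<in> planar_rooks k \<longleftrightarrow> dom f \<subseteq> {1..k} \<and> ran f \<subseteq> {1..k} \<and> inj_on f (dom f)
    \<and> (\<forall>i\<in>dom f. \<forall>j\<in>dom f. i \<le> j \<longrightarrow> the (f i) \<le> the (f j))"
  by (simp add: planar_rook_monoid_def)

lemma finite_planar_rooks: "finite (planar_rooks k)"
proof -
  have "finite (\<Union>D\<in>Pow {1..k}. {f :: nat \<rightharpoonup> nat. dom f = D \<and> ran f \<subseteq> {1..k}})"
  proof (rule finite_UN_I)
    fix D assume "D \<in> Pow {1..k}"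
    then have "finite D" by (meson PowD finite_atLeastAtMost finite_subset)
    then show "finite {f :: nat \<rightharpoonup> nat. dom f = D \<and> ran f \<subseteq> {1..k}}"
      by (rule finite_set_of_finite_maps) simp
  qed simp
  moreover have "planar_rooks k \<subseteq> (\<Union>D\<in>Pow {1..k}. {f. dom f = D \<and> ran f \<subseteq> {1..k}})"
    unfolding planar_rook_monoid_def by force
  ultimately show ?thesis by (rule rev_finite_subset)
qed

lemma planar_rook_comp:
  assumes "f \<in> planar_rooks k" "g \<in> planar_rooks k"
  shows "f \<circ>\<^sub>m g \<in> planar_rooks k"
proof -
  have val: "\<exists>j. g i = Some j \<and> j \<in> dom f \<and> (f \<circ>\<^sub>m g) i = f j \<and> i \<in> dom g" if "i \<in> dom (f \<circ>\<^sub>m g)" for i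
    using that by (auto simp: map_comp_def dom_def split: option.splits)
  have "ran (f \<circ>\<^sub>m g) \<subseteq> {1..k}"
    using assms by (force simp: planar_rooks_iff map_comp_def ran_def split: option.splits)
  moreover have "dom (f \<circ>\<^sub>m g) \<subseteq> {1..k}"
    using assms val by (auto simp: planar_rooks_iff)
  moreover have "inj_on (f \<circ>\<^sub>m g) (dom (f \<circ>\<^sub>m g))"
  proof (rule inj_onI)
    fix i j assume "i \<in> dom (f \<circ>\<^sub>m g)" "j \<in> dom (f \<circ>\<^sub>m g)" "(f \<circ>\<^sub>m g) i = (f \<circ>\<^sub>m g) j"
    with val[of i] val[of j] assms show "i = j" by (metis planar_rooks_iff inj_onD option.inject)
  qed
  moreover have "the ((f \<circ>\<^sub>m g) i) \<le> the ((f \<circ>\<^sub>m g) j)"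
    if "i \<in> dom (f \<circ>\<^sub>m g)" "j \<in> dom (f \<circ>\<^sub>m g)" "i \<le> j" for i j
    using val[OF that(1)] val[OF that(2)] assms that(3) by (metis planar_rooks_iff option.sel)
  ultimately show ?thesis by (simp add: planar_rooks_iff)
qed

lemma planar_rook_one: "(\<lambda>i. if i \<in> {1..k} then Some i else None) \<in> planar_rooks k"
  by (auto simp: planar_rooks_iff dom_def ran_def inj_on_def split: if_splits)

text \<open>
  Both \<open>S\<close> and \<open>T\<close> are enumerated increasingly by the same initial segment of the natural numbers;
  \<open>f\<close> matches elements with the same index.
\<close>

lemma planar_rook_exists:
  assumes S: "S \<subseteq> {1..k}" and T: "T \<subseteq> {1..k}" and card: "card S = card T"
  obtains f where "f \<in> planar_rooks k" "dom f = S" "f ` S = Some ` T"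
proof -
  have fin: "finite S" "finite T" using S T by (auto intro: finite_subset)
  obtain p where p: "bij_betw p {..<card S} S" "strict_mono_on {..<card S} p"
    using ex_bij_betw_strict_mono_card[OF fin(1)] .
  obtain q where q: "bij_betw q {..<card S} T" "strict_mono_on {..<card S} q"
    using ex_bij_betw_strict_mono_card[OF fin(2)] unfolding card .
  let ?n = "inv_into {..<card S} p"
  have n: "?n i < card S" "p (?n i) = i" if "i \<in> S" for i
    using p that inv_into_into[of i p "{..<card S}"]
    by (auto simp: bij_betw_def f_inv_into_f)
  define f where "f = (\<lambda>i. if i \<in> S then Some (q (?n i)) else None)"
  have bij: "bij_betw (\<lambda>i. q (?n i)) S T"
    using bij_betw_trans[OF bij_betw_inv_into[OF p(1)] q(1)] by (simp add: comp_def)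
  have dom: "dom f = S" by (auto simp: f_def split: if_splits)
  have im: "f ` S = Some ` T"
    using bij by (auto simp: f_def bij_betw_def)
  have "ran f \<subseteq> {1..k}" using T bij by (auto simp: ran_def f_def bij_betw_def split: if_splits)
  moreover have "inj_on f S" using bij by (auto simp: f_def bij_betw_def inj_on_def)
  moreover have "the (f i) \<le> the (f j)" if ij: "i \<in> S" "j \<in> S" "i \<le> j" for i j
  proof -
    have "?n i \<le> ?n j"
    proof (rule ccontr)
      assume "\<not> ?n i \<le> ?n j"
      then have "p (?n j) < p (?n i)"
        using n(1)[OF ij(1)] n(1)[OF ij(2)] by (intro strict_mono_onD[OF p(2)]) auto
      then show False unfolding n(2)[OF ij(1)] n(2)[OF ij(2)] using ij(3) by simp
    qed
    then have "q (?n i) \<le> q (?n j)"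
      using n(1)[OF ij(1)] n(1)[OF ij(2)] strict_mono_onD[OF q(2), of "?n i" "?n j"]
      by (cases "?n i = ?n j") simp_all
    then show ?thesis using ij by (simp add: f_def)
  qed
  ultimately have "f \<in> planar_rooks k" using S dom by (simp add: planar_rooks_iff)
  then show thesis using that dom im by blast
qed

text \<open>
  A planar rook is strictly increasing, so it takes the increasing list of its domain to the
  increasing list of its range.
\<close>

lemma planar_rook_unique:
  assumes f: "f \<in> planar_rooks k" and g: "g \<in> planar_rooks k"
    and dom: "dom f = dom g" and im: "f ` dom f = g ` dom f"
  shows "f = g"
proof -
  let ?xs = "sorted_list_of_set (dom f)"
  have fin: "finite (dom f)" using f by (auto simp: planar_rooks_iff intro: finite_subset)
  have list: "map (\<lambda>i. the (h i)) ?xs = sorted_list_of_set ((\<lambda>i. the (h i)) ` dom f)"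
    if h: "h \<in> planar_rooks k" "dom h = dom f" for h
  proof (rule sorted_list_of_set_unique[THEN iffD1, symmetric])
    have mono: "the (h i) < the (h j)" if ij: "i \<in> dom f" "j \<in> dom f" "i < j" for i j
    proof -
      have "the (h i) \<le> the (h j)" using h ij by (simp add: planar_rooks_iff)
      moreover have "h i \<noteq> h j"
        using h ij inj_onD[of h "dom h" i j] by (auto simp: planar_rooks_iff)
      then have "the (h i) \<noteq> the (h j)" using ij h(2) by (metis domIff option.expand)
      ultimately show ?thesis by simp
    qed
    have "inj_on (\<lambda>i. the (h i)) (dom f)"
      by (rule inj_onI) (metis mono linorder_neqE_nat less_irrefl)
    moreover have "sorted_wrt (<) (map (\<lambda>i. the (h i)) ?xs)"
      unfolding sorted_wrt_map
      by (rule sorted_wrt_mono_rel[OF _ strict_sorted_list_of_set]) (auto simp: fin intro!: mono)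
    ultimately show "sorted_wrt (<) (map (\<lambda>i. the (h i)) ?xs)
      \<and> set (map (\<lambda>i. the (h i)) ?xs) = (\<lambda>i. the (h i)) ` dom f
      \<and> length (map (\<lambda>i. the (h i)) ?xs) = card ((\<lambda>i. the (h i)) ` dom f)"
      by (simp add: fin card_image)
  qed (simp add: fin)
  have "(\<lambda>i. the (f i)) ` dom f = (\<lambda>i. the (g i)) ` dom f"
    using arg_cong[OF im, of "image the"] by (simp add: image_image)
  then have "map (\<lambda>i. the (f i)) ?xs = map (\<lambda>i. the (g i)) ?xs"
    using list[OF f refl] list[OF g dom[symmetric]] by simp
  then have "the (f i) = the (g i)" if "i \<in> dom f" for i
    using that fin by (simp add: map_eq_conv)
  then show ?thesis
    using dom by (intro ext) (metis domIff option.expand)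
qed

text \<open>
  Since \<open>f\<close> takes values in an option type, the equation says at once that \<open>f\<close> is defined on all of
  \<open>neg_set k s\<close> and that its image is \<open>neg_set k r\<close>.
\<close>

definition carries :: "nat \<Rightarrow> (nat \<rightharpoonup> nat) \<Rightarrow> (nat \<Rightarrow> int) \<Rightarrow> (nat \<Rightarrow> int) \<Rightarrow> bool" where
  "carries k f s r \<longleftrightarrow> f ` neg_set k s = Some ` neg_set k r"

lemma carries_dom: "carries k f s r \<Longrightarrow> neg_set k s \<subseteq> dom f"
  by (force simp: carries_def dom_def)

lemma carries_neg_count:
  assumes "f \<in> planar_rooks k" "carries k f s r"
  shows "neg_count k s = neg_count k r"
proof -
  have "inj_on f (neg_set k s)"
    by (rule inj_on_subset[OF _ carries_dom[OF assms(2)]]) (use assms(1) in \<open>simp add: planar_rooks_iff\<close>)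
  then have "card (f ` neg_set k s) = neg_count k s"
    by (simp add: card_image neg_count_eq_card)
  then show ?thesis
    using assms(2) by (simp add: carries_def card_image neg_count_eq_card)
qed

lemma carries_unique:
  "carries k f s r \<Longrightarrow> carries k f s t \<Longrightarrow> r \<in> signs k \<Longrightarrow> t \<in> signs k \<Longrightarrow> r = t"
  by (simp add: carries_def inj_image_eq_iff neg_set_inject)

text \<open>
  The intermediate sequence \<open>t\<close> exists since the image of \<open>neg_set k s\<close> under \<open>g\<close> is a set of
  positions, hence the negative set of a sign sequence.
\<close>

lemma carries_comp:
  assumes g: "g \<in> planar_rooks k"
  shows "carries k (f \<circ>\<^sub>m g) s r \<longleftrightarrow> (\<exists>t\<in>signs k. carries k g s t \<and> carries k f t r)"
proof -
  have comp_image: "(f \<circ>\<^sub>m g) ` S = f ` U" if "g ` S = Some ` U" for S U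
  proof -
    have "(f \<circ>\<^sub>m g) ` S = case_option None f ` (g ` S)"
      by (simp add: image_image map_comp_def)
    then show ?thesis by (simp add: that image_image)
  qed
  show ?thesis
  proof
    assume c: "carries k (f \<circ>\<^sub>m g) s r"
    have gd: "neg_set k s \<subseteq> dom g"
      using carries_dom[OF c] by (auto simp: map_comp_def dom_def split: option.splits)
    define U where "U = (\<lambda>i. the (g i)) ` neg_set k s"
    have gU: "g ` neg_set k s = Some ` U"
      unfolding U_def image_image by (rule image_cong) (use gd in auto)
    have "U \<subseteq> {1..k}"
      using g gd by (force simp: U_def planar_rooks_iff ran_def)
    then obtain t where t: "t \<in> signs k" "neg_set k t = U" by (rule neg_set_surj)
    then show "\<exists>t\<in>signs k. carries k g s t \<and> carries k f t r"
      using c gU comp_image[OF gU] by (auto simp: carries_def)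
  next
    assume "\<exists>t\<in>signs k. carries k g s t \<and> carries k f t r"
    then show "carries k (f \<circ>\<^sub>m g) s r" by (metis carries_def comp_image)
  qed
qed

text \<open>
  The linear extension of the action of planar rooks on the tensors \<open>v\<^sub>s\<close>, expanded in matrix units.
\<close>

definition rook_rep :: "nat \<Rightarrow> ((nat \<rightharpoonup> nat) \<Rightarrow> complex) \<Rightarrow> tensor \<Rightarrow> tensor" where
  "rook_rep k x = (\<Sum>(r, s)\<in>signs k \<times> signs k.
     escale (\<Sum>f\<in>planar_rooks k. x f * of_bool (carries k f s r)) (E_unit k r s))"

lemma entry_sum_E_unit:
  assumes "r \<in> signs k" "s \<in> signs k" "P \<subseteq> signs k \<times> signs k"
  shows "entry k (\<Sum>(t, u)\<in>P. escale (c t u) (E_unit k t u)) r s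
    = (if (r, s) \<in> P then c r s else 0)"
proof -
  have fin: "finite P" using assms(3) finite_signs by (auto intro: finite_subset)
  have "entry k (\<Sum>(t, u)\<in>P. escale (c t u) (E_unit k t u)) r s
      = (\<Sum>p\<in>P. entry k (escale (c (fst p) (snd p)) (E_unit k (fst p) (snd p))) r s)"
    by (simp add: entry_def sum_apply case_prod_beta)
  also have "\<dots> = (\<Sum>p\<in>P. if (r, s) = p then c (fst p) (snd p) else 0)"
  proof (rule sum.cong)
    fix p assume "p \<in> P"
    then have "fst p \<in> signs k" using assms(3) by auto
    then show "entry k (escale (c (fst p) (snd p)) (E_unit k (fst p) (snd p))) r s
        = (if (r, s) = p then c (fst p) (snd p) else 0)"
      using assms(2) by (auto simp: entry_escale entry_E_unit)
  qed simp
  also have "\<dots> = (if (r, s) \<in> P then c r s else 0)"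
    using fin by simp
  finally show ?thesis .
qed

lemma sum_E_unit_in_tensor_End: "(\<Sum>(t, u)\<in>P. escale (c t u) (E_unit k t u)) \<in> tensor_End k"
  unfolding case_prod_beta
  by (intro endo.subspace_sum[OF subspace_tensor_End] endo.subspace_scale[OF subspace_tensor_End]
      E_unit_in_tensor_End)

lemma entry_rook_rep:
  "r \<in> signs k \<Longrightarrow> s \<in> signs k
    \<Longrightarrow> entry k (rook_rep k x) r s = (\<Sum>f\<in>planar_rooks k. x f * of_bool (carries k f s r))"
  unfolding rook_rep_def by (subst entry_sum_E_unit) auto

lemma rook_rep_in_weight_End: "rook_rep k x \<in> weight_End k"
proof -
  have "entry k (rook_rep k x) r s = 0"
    if "r \<in> signs k" "s \<in> signs k" "neg_count k r \<noteq> neg_count k s" for r s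
    unfolding entry_rook_rep[OF that(1,2)] using that(3)
    by (intro sum.neutral) (auto dest: carries_neg_count)
  then show ?thesis
    using sum_E_unit_in_tensor_End by (simp add: weight_End_def rook_rep_def)
qed

lemma rook_rep_eqI:
  assumes "g \<in> tensor_End k"
    and "\<And>r s. r \<in> signs k \<Longrightarrow> s \<in> signs k
      \<Longrightarrow> entry k g r s = (\<Sum>f\<in>planar_rooks k. x f * of_bool (carries k f s r))"
  shows "rook_rep k x = g"
  by (rule tensor_End_eqI[OF weight_End_subset[OF rook_rep_in_weight_End] assms(1)])
     (simp add: entry_rook_rep assms(2))

lemma rook_rep_add: "rook_rep k (x + y) = rook_rep k x + rook_rep k y"
proof (rule rook_rep_eqI)
  show "rook_rep k x + rook_rep k y \<in> tensor_End k"
    by (intro endo.subspace_add[OF subspace_tensor_End] weight_End_subset rook_rep_in_weight_End)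
qed (simp add: entry_add entry_rook_rep sum.distrib distrib_right)

lemma rook_rep_scale: "rook_rep k (\<lambda>f. c * x f) = escale c (rook_rep k x)"
proof (rule rook_rep_eqI)
  show "escale c (rook_rep k x) \<in> tensor_End k"
    by (intro endo.subspace_scale[OF subspace_tensor_End] weight_End_subset rook_rep_in_weight_End)
qed (simp add: entry_escale entry_rook_rep sum_distrib_left mult.assoc)

lemma planar_rook_algebra_simps:
  "x \<in> carrier (planar_rook_algebra k) \<longleftrightarrow> (\<forall>f. f \<notin> planar_rooks k \<longrightarrow> x f = 0)"
  "x \<oplus>\<^bsub>planar_rook_algebra k\<^esub> y = x + y"
  "c \<odot>\<^bsub>planar_rook_algebra k\<^esub> x = (\<lambda>f. c * x f)"
  "\<one>\<^bsub>planar_rook_algebra k\<^esub> f = of_bool (f = (\<lambda>i. if i \<in> {1..k} then Some i else None))"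
proof -
  have "finite {f. x f \<noteq> 0}" if "{f. x f \<noteq> 0} \<subseteq> planar_rooks k"
    using that finite_planar_rooks by (rule finite_subset)
  then show "x \<in> carrier (planar_rook_algebra k) \<longleftrightarrow> (\<forall>f. f \<notin> planar_rooks k \<longrightarrow> x f = 0)"
    unfolding planar_rook_algebra_def monoid_algebra_def partial_object.select_convs by blast
qed (simp_all add: planar_rook_algebra_def monoid_algebra_def planar_rook_monoid_def times_fun_def)

lemma planar_rook_algebra_mult:
  assumes x: "x \<in> carrier (planar_rook_algebra k)" and y: "y \<in> carrier (planar_rook_algebra k)"
  shows "(x \<otimes>\<^bsub>planar_rook_algebra k\<^esub> y) h
    = (\<Sum>f\<in>planar_rooks k. \<Sum>g\<in>planar_rooks k. if f \<circ>\<^sub>m g = h then x f * y g else 0)"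
proof -
  have "(x \<otimes>\<^bsub>planar_rook_algebra k\<^esub> y) h
      = (\<Sum>f\<in>{f. x f \<noteq> 0}. \<Sum>g\<in>{g. y g \<noteq> 0}. if f \<circ>\<^sub>m g = h then x f * y g else 0)"
    by (simp add: planar_rook_algebra_def monoid_algebra_def planar_rook_monoid_def)
  also have "\<dots> = (\<Sum>f\<in>planar_rooks k. \<Sum>g\<in>{g. y g \<noteq> 0}. if f \<circ>\<^sub>m g = h then x f * y g else 0)"
    using x by (intro sum.mono_neutral_left finite_planar_rooks)
      (auto simp: planar_rook_algebra_simps intro!: sum.neutral split: if_splits)
  also have "\<dots> = (\<Sum>f\<in>planar_rooks k. \<Sum>g\<in>planar_rooks k. if f \<circ>\<^sub>m g = h then x f * y g else 0)"
    using y by (intro sum.cong refl sum.mono_neutral_left finite_planar_rooks)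
      (auto simp: planar_rook_algebra_simps)
  finally show ?thesis .
qed

lemma planar_rook_algebra_mult_closed:
  assumes x: "x \<in> carrier (planar_rook_algebra k)" and y: "y \<in> carrier (planar_rook_algebra k)"
  shows "x \<otimes>\<^bsub>planar_rook_algebra k\<^esub> y \<in> carrier (planar_rook_algebra k)"
  unfolding planar_rook_algebra_simps(1) planar_rook_algebra_mult[OF assms]
  by (auto intro!: sum.neutral dest: planar_rook_comp)

text \<open>
  In matrices, this is the identity \<open>carries_comp\<close>: as \<open>t\<close> is unique there, the matrix of \<open>f \<circ>\<^sub>m g\<close> is
  the product of the matrices of \<open>f\<close> and \<open>g\<close>.
\<close>

lemma rook_rep_mult:
  assumes x: "x \<in> carrier (planar_rook_algebra k)" and y: "y \<in> carrier (planar_rook_algebra k)"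
  shows "rook_rep k (x \<otimes>\<^bsub>planar_rook_algebra k\<^esub> y) = rook_rep k x \<circ> rook_rep k y"
proof (rule rook_rep_eqI)
  note E = weight_End_subset[OF rook_rep_in_weight_End]
  show "rook_rep k x \<circ> rook_rep k y \<in> tensor_End k" by (rule tensor_End_comp[OF E E])
  fix r s assume rs: "r \<in> signs k" "s \<in> signs k"
  let ?P = "planar_rooks k" and ?c = "\<lambda>f s r. of_bool (carries k f s r) :: complex"
  have c_comp: "?c (f \<circ>\<^sub>m g) s r = (\<Sum>t\<in>signs k. ?c f t r * ?c g s t)" if g: "g \<in> ?P" for f g
  proof (cases "\<exists>t\<in>signs k. carries k g s t \<and> carries k f t r")
    case True
    then obtain t where t: "t \<in> signs k" "carries k g s t" "carries k f t r" by auto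
    have "(\<Sum>u\<in>signs k. ?c f u r * ?c g s u) = (\<Sum>u\<in>signs k. if t = u then 1 else 0)"
    proof (rule sum.cong)
      fix u assume u: "u \<in> signs k"
      have "carries k g s u \<longleftrightarrow> t = u" using carries_unique[OF t(2) _ t(1) u] t(2) by blast
      then show "?c f u r * ?c g s u = (if t = u then 1 else 0)" using t(3) by auto
    qed simp
    then show ?thesis using t True by (simp add: carries_comp[OF g] finite_signs)
  next
    case False
    then show ?thesis
      unfolding carries_comp[OF g] by (subst sum.neutral) auto
  qed
  have "(\<Sum>h\<in>?P. (x \<otimes>\<^bsub>planar_rook_algebra k\<^esub> y) h * ?c h s r)
      = (\<Sum>h\<in>?P. \<Sum>f\<in>?P. \<Sum>g\<in>?P. if f \<circ>\<^sub>m g = h then x f * y g * ?c h s r else 0)"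
    unfolding planar_rook_algebra_mult[OF assms] sum_distrib_right
    by (intro sum.cong refl) auto
  also have "\<dots> = (\<Sum>f\<in>?P. \<Sum>g\<in>?P. \<Sum>h\<in>?P. if f \<circ>\<^sub>m g = h then x f * y g * ?c h s r else 0)"
    by (subst sum.swap) (intro sum.cong refl sum.swap)
  also have "\<dots> = (\<Sum>f\<in>?P. \<Sum>g\<in>?P. x f * y g * ?c (f \<circ>\<^sub>m g) s r)"
    by (intro sum.cong refl) (simp add: finite_planar_rooks planar_rook_comp)
  also have "\<dots> = (\<Sum>f\<in>?P. \<Sum>g\<in>?P. \<Sum>t\<in>signs k. (x f * ?c f t r) * (y g * ?c g s t))"
    by (intro sum.cong refl) (simp only: c_comp sum_distrib_left mult.assoc mult.left_commute)
  also have "\<dots> = (\<Sum>f\<in>?P. \<Sum>t\<in>signs k. \<Sum>g\<in>?P. (x f * ?c f t r) * (y g * ?c g s t))"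
    by (intro sum.cong refl sum.swap)
  also have "\<dots> = (\<Sum>t\<in>signs k. \<Sum>f\<in>?P. \<Sum>g\<in>?P. (x f * ?c f t r) * (y g * ?c g s t))"
    by (rule sum.swap)
  also have "\<dots> = entry k (rook_rep k x \<circ> rook_rep k y) r s"
    unfolding entry_comp[OF E E]
    by (intro sum.cong refl) (simp add: entry_rook_rep rs sum_product)
  finally show "entry k (rook_rep k x \<circ> rook_rep k y) r s
      = (\<Sum>h\<in>?P. (x \<otimes>\<^bsub>planar_rook_algebra k\<^esub> y) h * ?c h s r)" ..
qed

lemma rook_rep_one:
  "rook_rep k \<one>\<^bsub>planar_rook_algebra k\<^esub> = (\<lambda>x. if x \<in> tensor_space k then x else 0)"
proof (rule rook_rep_eqI[OF tensor_End_one])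
  fix r s assume rs: "r \<in> signs k" "s \<in> signs k"
  let ?e = "\<lambda>i. if i \<in> {1..k} then Some i else None"
  have "?e ` neg_set k s = Some ` neg_set k s"
    by (rule image_cong) (auto simp: neg_set_def)
  then have "carries k ?e s r \<longleftrightarrow> r = s"
    using rs by (auto simp: carries_def inj_image_eq_iff neg_set_inject)
  moreover have "(\<Sum>f\<in>planar_rooks k. \<one>\<^bsub>planar_rook_algebra k\<^esub> f * of_bool (carries k f s r))
      = (\<Sum>f\<in>planar_rooks k. if ?e = f then of_bool (carries k f s r) else 0)"
    by (intro sum.cong refl) (auto simp: planar_rook_algebra_simps)
  ultimately show "entry k (\<lambda>x. if x \<in> tensor_space k then x else 0) r s
      = (\<Sum>f\<in>planar_rooks k. \<one>\<^bsub>planar_rook_algebra k\<^esub> f * of_bool (carries k f s r))"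
    using rs
    by (simp only: sum.delta'[OF finite_planar_rooks] planar_rook_one if_True)
       (simp add: entry_def basis_tensor_in_tensor_space basis_tensor_apply)
qed

lemma planar_rook_carries:
  assumes f: "f \<in> planar_rooks k"
  obtains r s where "r \<in> signs k" "s \<in> signs k" "neg_set k s = dom f" "carries k f s r"
proof -
  have "dom f \<subseteq> {1..k}" "ran f \<subseteq> {1..k}" using f by (simp_all add: planar_rooks_iff)
  then obtain r s where s: "s \<in> signs k" "neg_set k s = dom f"
    and r: "r \<in> signs k" "neg_set k r = ran f" by (metis neg_set_surj)
  have "f ` dom f = Some ` ran f" by (force simp: ran_def dom_def)
  then show thesis using that r s by (simp add: carries_def)
qed

text \<open>
  At the entry given by the domain and range of \<open>f\<close>, only extensions of \<open>f\<close> contribute. The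
  proper ones have larger domains, and their coefficients vanish by induction downwards on the size of
  the domain, so the entry equals \<open>d f\<close>.
\<close>

lemma rook_coefficients_zero:
  fixes d :: "(nat \<rightharpoonup> nat) \<Rightarrow> complex"
  assumes 0: "\<And>r s. r \<in> signs k \<Longrightarrow> s \<in> signs k
      \<Longrightarrow> (\<Sum>f\<in>planar_rooks k. d f * of_bool (carries k f s r)) = 0"
    and "f \<in> planar_rooks k"
  shows "d f = 0"
  using assms(2)
proof (induction "k - card (dom f)" arbitrary: f rule: less_induct)
  case less
  obtain r s where rs: "r \<in> signs k" "s \<in> signs k" and s: "neg_set k s = dom f"
    and c: "carries k f s r" by (rule planar_rook_carries[OF less.prems])
  have "d g * of_bool (carries k g s r) = (if f = g then d g else 0)" if g: "g \<in> planar_rooks k" for g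
  proof (cases "carries k g s r \<and> f \<noteq> g")
    case True
    then have "g ` dom f = f ` dom f" using c s by (simp add: carries_def)
    moreover have "dom f \<subseteq> dom g" using True carries_dom[of k g s r] s by simp
    ultimately have "dom f \<subset> dom g" using planar_rook_unique[OF less.prems g] True by auto
    moreover have "dom g \<subseteq> {1..k}" using g by (simp add: planar_rooks_iff)
    ultimately have "card (dom f) < card (dom g)" "card (dom g) \<le> k"
      using psubset_card_mono[of "dom g" "dom f"] card_mono[of "{1..k}" "dom g"]
      by (auto intro: finite_subset)
    then show ?thesis using less.hyps[of g] g True by auto
  next
    case False
    then show ?thesis using c by auto
  qed
  then have "(\<Sum>g\<in>planar_rooks k. d g * of_bool (carries k g s r)) = d f"
    using less.prems by (simp add: finite_planar_rooks cong: sum.cong)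
  then show ?case using 0[OF rs] by simp
qed

lemma inj_on_rook_rep: "inj_on (rook_rep k) (carrier (planar_rook_algebra k))"
proof (rule inj_onI)
  fix x y assume x: "x \<in> carrier (planar_rook_algebra k)"
    and y: "y \<in> carrier (planar_rook_algebra k)" and eq: "rook_rep k x = rook_rep k y"
  have "(\<Sum>f\<in>planar_rooks k. (x f - y f) * of_bool (carries k f s r)) = 0"
    if "r \<in> signs k" "s \<in> signs k" for r s
    using arg_cong[OF eq, of "\<lambda>g. entry k g r s"] that
    by (simp add: entry_rook_rep left_diff_distrib sum_subtractf)
  from rook_coefficients_zero[OF this] have "x f = y f" if "f \<in> planar_rooks k" for f
    using that by fastforce
  then show "x = y" using x y by (metis ext planar_rook_algebra_simps(1))
qed

lemma subspace_image_rook_rep: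
  "endo.subspace (rook_rep k ` carrier (planar_rook_algebra k))" (is "endo.subspace ?V")
proof (rule endo.subspaceI)
  let ?C = "carrier (planar_rook_algebra k)"
  have scale: "escale c u \<in> ?V" if u: "u \<in> ?V" for c u
  proof -
    obtain x where "x \<in> ?C" "u = rook_rep k x" using u by auto
    then show ?thesis
      by (intro image_eqI[of _ _ "\<lambda>f. c * x f"]) (auto simp: rook_rep_scale planar_rook_algebra_simps)
  qed
  then show "escale c u \<in> ?V" if "u \<in> ?V" for c u using that .
  have "\<one>\<^bsub>planar_rook_algebra k\<^esub> \<in> ?C"
    using planar_rook_one by (auto simp: planar_rook_algebra_simps)
  then have "escale 0 (rook_rep k \<one>\<^bsub>planar_rook_algebra k\<^esub>) \<in> ?V" by (intro scale imageI)
  then show "0 \<in> ?V" by (simp only: endo.scale_zero_left)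
  fix u v assume "u \<in> ?V" "v \<in> ?V"
  then obtain x y where "x \<in> ?C" "u = rook_rep k x" "y \<in> ?C" "v = rook_rep k y" by auto
  then show "u + v \<in> ?V"
    by (intro image_eqI[of _ _ "x + y"]) (auto simp: rook_rep_add planar_rook_algebra_simps)
qed

text \<open>
  The planar rook \<open>f\<close> from \<open>neg_set k s\<close> onto \<open>neg_set k r\<close> is represented by \<open>E_unit k r s\<close> plus the
  matrix units of its restrictions to proper subsets, which lie in the image by induction.
\<close>

lemma E_unit_in_image_rook_rep:
  assumes "r \<in> signs k" "s \<in> signs k" "neg_count k r = neg_count k s"
  shows "E_unit k r s \<in> rook_rep k ` carrier (planar_rook_algebra k)" (is "_ \<in> ?V")
  using assms
proof (induction "neg_count k s" arbitrary: r s rule: less_induct)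
  case less
  note V = subspace_image_rook_rep[of k]
  have "neg_set k s \<subseteq> {1..k}" "neg_set k r \<subseteq> {1..k}" "card (neg_set k s) = card (neg_set k r)"
    using less.prems by (auto simp: neg_set_def neg_count_eq_card)
  then obtain f where f: "f \<in> planar_rooks k" "dom f = neg_set k s"
    and im: "f ` neg_set k s = Some ` neg_set k r"
    by (rule planar_rook_exists)
  define \<delta> :: "(nat \<rightharpoonup> nat) \<Rightarrow> complex" where "\<delta> g = of_bool (g = f)" for g
  \<comment> \<open>The pairs in \<open>P\<close> index the restrictions of \<open>f\<close> to subsets of its domain.\<close>
  define P where "P = {(t, u). t \<in> signs k \<and> u \<in> signs k \<and> carries k f u t}"
  have P: "P \<subseteq> signs k \<times> signs k" by (auto simp: P_def)
  then have fin: "finite P" using finite_signs by (auto intro: finite_subset)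
  have "rook_rep k \<delta> = (\<Sum>(t, u)\<in>P. escale 1 (E_unit k t u))"
  proof (rule rook_rep_eqI[OF sum_E_unit_in_tensor_End])
    fix t u assume tu: "t \<in> signs k" "u \<in> signs k"
    have "(\<Sum>g\<in>planar_rooks k. \<delta> g * of_bool (carries k g u t))
        = (\<Sum>g\<in>planar_rooks k. if f = g then of_bool (carries k g u t) else 0)"
      by (intro sum.cong refl) (auto simp: \<delta>_def)
    also have "\<dots> = of_bool (carries k f u t)" using f by (simp add: finite_planar_rooks)
    finally show "entry k (\<Sum>(t, u)\<in>P. escale 1 (E_unit k t u)) t u
        = (\<Sum>g\<in>planar_rooks k. \<delta> g * of_bool (carries k g u t))"
      using entry_sum_E_unit[OF tu P, of "\<lambda>_ _. 1"] tu by (simp add: P_def)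
  qed
  moreover have "(r, s) \<in> P" using less.prems im by (simp add: P_def carries_def)
  ultimately have "rook_rep k \<delta> = E_unit k r s + (\<Sum>(t, u)\<in>P - {(r, s)}. E_unit k t u)"
    using sum.remove[OF fin \<open>(r, s) \<in> P\<close>, of "\<lambda>(t, u). E_unit k t u"] by simp
  then have "E_unit k r s = rook_rep k \<delta> - (\<Sum>(t, u)\<in>P - {(r, s)}. E_unit k t u)" by simp
  moreover have "rook_rep k \<delta> \<in> ?V"
    using f by (intro imageI) (auto simp: planar_rook_algebra_simps \<delta>_def)
  moreover have "(\<Sum>p\<in>P - {(r, s)}. case p of (t, u) \<Rightarrow> E_unit k t u) \<in> ?V"
  proof (rule endo.subspace_sum[OF V])
    fix p assume "p \<in> P - {(r, s)}"
    then obtain t u where p: "p = (t, u)" "t \<in> signs k" "u \<in> signs k" and c: "carries k f u t"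
      and ne: "(t, u) \<noteq> (r, s)" by (auto simp: P_def)
    have "neg_set k u \<noteq> neg_set k s"
    proof
      assume "neg_set k u = neg_set k s"
      then have "u = s" using p less.prems by (simp add: neg_set_inject)
      moreover have "carries k f s r" using im by (simp add: carries_def)
      ultimately have "t = r" using c carries_unique p less.prems by blast
      with \<open>u = s\<close> ne show False by simp
    qed
    moreover have "neg_set k u \<subseteq> neg_set k s" using carries_dom[OF c] f by simp
    ultimately have "neg_count k u < neg_count k s"
      unfolding neg_count_eq_card by (intro psubset_card_mono finite_neg_set) auto
    then show "(case p of (t, u) \<Rightarrow> E_unit k t u) \<in> ?V"
      unfolding p(1) prod.case by (rule less.hyps[OF _ p(2,3) carries_neg_count[OF f(1) c, symmetric]])
  qed
  ultimately show ?case by (simp only: endo.subspace_diff[OF V])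
qed

lemma image_rook_rep: "rook_rep k ` carrier (planar_rook_algebra k) = weight_End k"
proof
  show "rook_rep k ` carrier (planar_rook_algebra k) \<subseteq> weight_End k"
    using rook_rep_in_weight_End by auto
  have "endo.span {E_unit k r s | r s. r \<in> signs k \<and> s \<in> signs k \<and> neg_count k r = neg_count k s}
      \<subseteq> rook_rep k ` carrier (planar_rook_algebra k)"
    by (rule endo.span_minimal[OF _ subspace_image_rook_rep]) (auto intro: E_unit_in_image_rook_rep)
  then show "weight_End k \<subseteq> rook_rep k ` carrier (planar_rook_algebra k)"
    using basis_of_weight_End(1)[of k] by (simp add: basis_of_def)
qed

text \<open>
  As for modules, the isomorphism is given by its inverse. This suits \<open>rook_rep\<close>, which leads from the
  planar rook algebra to the centralizer algebra; the opposite direction would need a Moebius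
  inversion over the subsets of a domain.
\<close>

lemma algebra_isomorphicI_inverse:
  assumes bij: "bij_betw \<psi> (carrier B) (carrier A)"
    and add: "\<And>x y. x \<in> carrier B \<Longrightarrow> y \<in> carrier B
        \<Longrightarrow> x \<oplus>\<^bsub>B\<^esub> y \<in> carrier B \<and> \<psi> (x \<oplus>\<^bsub>B\<^esub> y) = \<psi> x \<oplus>\<^bsub>A\<^esub> \<psi> y"
    and mult: "\<And>x y. x \<in> carrier B \<Longrightarrow> y \<in> carrier B
        \<Longrightarrow> x \<otimes>\<^bsub>B\<^esub> y \<in> carrier B \<and> \<psi> (x \<otimes>\<^bsub>B\<^esub> y) = \<psi> x \<otimes>\<^bsub>A\<^esub> \<psi> y"
    and one: "\<one>\<^bsub>B\<^esub> \<in> carrier B \<and> \<psi> \<one>\<^bsub>B\<^esub> = \<one>\<^bsub>A\<^esub>"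
    and scale: "\<And>c x. x \<in> carrier B
        \<Longrightarrow> c \<odot>\<^bsub>B\<^esub> x \<in> carrier B \<and> \<psi> (c \<odot>\<^bsub>B\<^esub> x) = c \<odot>\<^bsub>A\<^esub> \<psi> x"
  shows "algebra_isomorphic A B"
proof -
  let ?\<phi> = "inv_into (carrier B) \<psi>"
  have \<phi>: "?\<phi> a \<in> carrier B" "\<psi> (?\<phi> a) = a" if "a \<in> carrier A" for a
    using bij that by (auto simp: bij_betw_def inv_into_into f_inv_into_f)
  have \<phi>_eq: "?\<phi> a = x" if "x \<in> carrier B" "\<psi> x = a" for a x
    using bij that by (auto simp: bij_betw_def)
  have "?\<phi> \<in> ring_iso A B"
    unfolding ring_iso_def ring_hom_def
    using bij_betw_inv_into[OF bij] add mult one \<phi> by (auto intro!: \<phi>_eq)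
  moreover have "?\<phi> (c \<odot>\<^bsub>A\<^esub> a) = c \<odot>\<^bsub>B\<^esub> ?\<phi> a" if "a \<in> carrier A" for c a
    using scale \<phi>[OF that] by (auto intro!: \<phi>_eq)
  ultimately show ?thesis unfolding algebra_isomorphic_def by blast
qed

lemma Z_alg_isomorphic_planar_rook_algebra:
  assumes z: "cmod \<zeta> = 1" and nr: "\<forall>n::nat. n > 0 \<longrightarrow> \<zeta> ^ n \<noteq> 1"
  shows "algebra_isomorphic (Z_alg k \<zeta>) (planar_rook_algebra k)"
proof (rule algebra_isomorphicI_inverse)
  note Z = Z_alg_simps[OF z nr]
  let ?B = "planar_rook_algebra k"
  show "bij_betw (rook_rep k) (carrier ?B) (carrier (Z_alg k \<zeta>))"
    by (simp add: Z bij_betw_def inj_on_rook_rep image_rook_rep)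
  show "x \<oplus>\<^bsub>?B\<^esub> y \<in> carrier ?B
      \<and> rook_rep k (x \<oplus>\<^bsub>?B\<^esub> y) = rook_rep k x \<oplus>\<^bsub>Z_alg k \<zeta>\<^esub> rook_rep k y"
    if "x \<in> carrier ?B" "y \<in> carrier ?B" for x y
    using that by (simp add: Z rook_rep_add planar_rook_algebra_simps)
  show "x \<otimes>\<^bsub>?B\<^esub> y \<in> carrier ?B
      \<and> rook_rep k (x \<otimes>\<^bsub>?B\<^esub> y) = rook_rep k x \<otimes>\<^bsub>Z_alg k \<zeta>\<^esub> rook_rep k y"
    if "x \<in> carrier ?B" "y \<in> carrier ?B" for x y
    using that by (simp add: Z rook_rep_mult planar_rook_algebra_mult_closed)
  show "\<one>\<^bsub>?B\<^esub> \<in> carrier ?B \<and> rook_rep k \<one>\<^bsub>?B\<^esub> = \<one>\<^bsub>Z_alg k \<zeta>\<^esub>"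
    using planar_rook_one[of k] by (auto simp: Z rook_rep_one planar_rook_algebra_simps)
  show "c \<odot>\<^bsub>?B\<^esub> x \<in> carrier ?B \<and> rook_rep k (c \<odot>\<^bsub>?B\<^esub> x) = c \<odot>\<^bsub>Z_alg k \<zeta>\<^esub> rook_rep k x"
    if "x \<in> carrier ?B" for c x
    using that by (simp add: Z rook_rep_scale planar_rook_algebra_simps)
qed

section \<open>The structure of the centralizer algebra\<close>

theorem theorem2p22:
  fixes k :: nat and \<theta> :: real and \<zeta> :: complex
  assumes "k \<ge> 1"
    and "\<zeta> = exp (\<i> * of_real \<theta>)"
    and "\<forall>n::nat. n > 0 \<longrightarrow> \<zeta> ^ n \<noteq> 1"
  shows
    "(basis_of escale
        {E_unit k r s | r s. r \<in> signs k \<and> s \<in> signs k \<and> neg_count k r = neg_count k s}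
        (carrier (Z_alg k \<zeta>))
      \<and> (\<forall>r\<in>signs k. \<forall>s\<in>signs k. E_unit k r s \<in> tensor_End k)
      \<and> (\<forall>r\<in>signs k. \<forall>s\<in>signs k. \<forall>t\<in>signs k.
           E_unit k r s (basis_tensor k t) = (if s = t then basis_tensor k r else 0))
      \<and> (\<forall>r\<in>signs k. \<forall>s\<in>signs k. \<forall>t\<in>signs k. \<forall>u\<in>signs k.
           E_unit k r s \<circ> E_unit k t u = (if s = t then E_unit k r u else 0)))
    \<and>
     (labels k \<zeta> = {int k - 2 * int a | a. a \<in> {0..k}}
      \<and> (\<forall>l\<in>labels k \<zeta>. irreducible_module (Z_alg k \<zeta>) tscale (Z_mod k \<zeta> l) eval_act)
      \<and> (\<forall>l\<in>labels k \<zeta>. \<forall>m\<in>labels k \<zeta>.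
           module_isomorphic (Z_alg k \<zeta>) tscale (Z_mod k \<zeta> l) eval_act tscale (Z_mod k \<zeta> m) eval_act
           \<longrightarrow> l = m)
      \<and> (\<forall>(sc :: complex \<Rightarrow> 'w::ab_group_add \<Rightarrow> 'w) W act.
           irreducible_module (Z_alg k \<zeta>) sc W act \<longrightarrow>
           (\<exists>l\<in>labels k \<zeta>. module_isomorphic (Z_alg k \<zeta>) sc W act tscale (Z_mod k \<zeta> l) eval_act))
      \<and> (\<forall>a\<in>{0..k}.
           basis_of tscale {basis_tensor k r | r. r \<in> signs k \<and> neg_count k r = a}
             (Z_mod k \<zeta> (int k - 2 * int a))
           \<and> vector_space.dim tscale (Z_mod k \<zeta> (int k - 2 * int a)) = k choose a
           \<and> group_algebra_bimodule (C_inf \<zeta>) (Z_alg k \<zeta>) tscale (Z_mod k \<zeta> (int k - 2 * int a))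
               (diag_act k) eval_act))
    \<and>
     (vector_space.dim escale (carrier (Z_alg k \<zeta>)) = (\<Sum>a=0..k. (k choose a)\<^sup>2)
      \<and> (\<Sum>a=0..k. (k choose a)\<^sup>2) = (2 * k) choose k
      \<and> (2 * k) choose k = coeff ([:1, 1:] ^ (2 * k) :: nat poly) k)
    \<and>
     algebra_isomorphic (Z_alg k \<zeta>) (planar_rook_algebra k)"
proof -
  have z: "cmod \<zeta> = 1" using assms(2) by (simp add: norm_exp_eq_Re)
  note nr = assms(3)
  note Z = Z_alg_simps(1)[OF z nr, of k] and W = Z_mod_weight_space[OF z nr, of k]
    and L = labels_eq[OF z nr, of k]
  have label: "\<exists>a\<le>k. l = int k - 2 * int a \<and> Z_mod k \<zeta> l = weight_space k a" if "l \<in> labels k \<zeta>" for l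
    using that by (auto simp: L W)
  have a: "basis_of escale
        {E_unit k r s | r s. r \<in> signs k \<and> s \<in> signs k \<and> neg_count k r = neg_count k s}
        (carrier (Z_alg k \<zeta>))"
    by (simp only: Z basis_of_weight_End)
  have irr: "\<forall>l\<in>labels k \<zeta>. irreducible_module (Z_alg k \<zeta>) tscale (Z_mod k \<zeta> l) eval_act"
    using label irreducible_weight_space[OF z nr] by force
  have noniso: "\<forall>l\<in>labels k \<zeta>. \<forall>m\<in>labels k \<zeta>.
      module_isomorphic (Z_alg k \<zeta>) tscale (Z_mod k \<zeta> l) eval_act tscale (Z_mod k \<zeta> m) eval_act
      \<longrightarrow> l = m"
    using label weight_spaces_not_isomorphic[OF z nr] by metis
  have complete: "\<forall>(sc :: complex \<Rightarrow> 'w::ab_group_add \<Rightarrow> 'w) W act.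
      irreducible_module (Z_alg k \<zeta>) sc W act \<longrightarrow>
      (\<exists>l\<in>labels k \<zeta>. module_isomorphic (Z_alg k \<zeta>) sc W act tscale (Z_mod k \<zeta> l) eval_act)"
  proof (intro allI impI)
    fix sc :: "complex \<Rightarrow> 'w \<Rightarrow> 'w" and U act
    assume "irreducible_module (Z_alg k \<zeta>) sc U act"
    then obtain a where "a \<le> k"
      "module_isomorphic (Z_alg k \<zeta>) sc U act tscale (weight_space k a) eval_act"
      by (rule irreducible_module_is_weight_space[OF z nr])
    then show "\<exists>l\<in>labels k \<zeta>. module_isomorphic (Z_alg k \<zeta>) sc U act tscale (Z_mod k \<zeta> l) eval_act"
      by (intro bexI[of _ "int k - 2 * int a"]) (auto simp: L W)
  qed
  have sq: "(\<Sum>a=0..k. (k choose a)\<^sup>2) = (2 * k) choose k"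
    using choose_square_sum[of k] by (simp add: atLeast0AtMost)
  have co: "(2 * k) choose k = coeff ([:1, 1:] ^ (2 * k) :: nat poly) k"
    by (simp add: coeff_linear_poly_power)
  have End: "\<forall>r\<in>signs k. \<forall>s\<in>signs k. E_unit k r s \<in> tensor_End k"
    by (simp add: E_unit_in_tensor_End)
  have E_vec: "\<forall>r\<in>signs k. \<forall>s\<in>signs k. \<forall>t\<in>signs k.
      E_unit k r s (basis_tensor k t) = (if s = t then basis_tensor k r else 0)"
    by (intro ballI E_unit_basis_tensor)
  have E_E: "\<forall>r\<in>signs k. \<forall>s\<in>signs k. \<forall>t\<in>signs k. \<forall>u\<in>signs k.
      E_unit k r s \<circ> E_unit k t u = (if s = t then E_unit k r u else 0)"
    by (intro ballI E_unit_comp)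
  have weights: "\<forall>a\<in>{0..k}.
      basis_of tscale {basis_tensor k r | r. r \<in> signs k \<and> neg_count k r = a}
        (Z_mod k \<zeta> (int k - 2 * int a))
      \<and> vector_space.dim tscale (Z_mod k \<zeta> (int k - 2 * int a)) = k choose a
      \<and> group_algebra_bimodule (C_inf \<zeta>) (Z_alg k \<zeta>) tscale (Z_mod k \<zeta> (int k - 2 * int a))
          (diag_act k) eval_act"
    unfolding W by (intro ballI conjI basis_of_weight_space bimodule_weight_space[OF z nr])
  have dim: "vector_space.dim escale (carrier (Z_alg k \<zeta>)) = (\<Sum>a=0..k. (k choose a)\<^sup>2)"
    unfolding Z by (rule basis_of_weight_End)
  show ?thesis
    by (intro conjI a End E_vec E_E L irr noniso complete weights dim sq co
        Z_alg_isomorphic_planar_rook_algebra[OF z nr])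
qed

end
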